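(* Let $P(\lambda)=\lambda^2A+\lambda Q+\epsilon A^{H}$ be an $(H,\epsilon)$-palindromic quadratic matrix polynomial with $A,Q\in\mathbb{C}^{n\times n}$, $A$ nonsingular, $Q^H=\epsilon Q$, and let $(X,J)$ be a standard pair of $P(\lambda)$ with $X=[X_1,\dots,X_r]$, $J=\mathrm{diag}(J_1,\dots,J_r)$ in the Jordan canonical form described in the context. Suppose that all eigenvalues of $P(\lambda)$ are semi-simple. Then there exists a standard pair $(\tilde X,J)$ of $P(\lambda)$ such that the corresponding matrix $\Gamma\in\mathcal{S}_{(J,H,\epsilon)}$ can be expressed as $$\Gamma=\mathrm{diag}\left(\begin{bmatrix}0&I_{n_1}\\-\epsilon I_{n_1}&0\end{bmatrix},\dots,\begin{bmatrix}0&I_{n_l}\\-\epsilon I_{n_l}&0\end{bmatrix},\mathfrak{E}_{l+1},\dots,\mathfrak{E}_r\right),$$ where, for $j=l+1,\dots,r$, $\mathfrak{E}_j=\mathrm{diag}(\pm{\rm i},\dots,\pm{\rm i})$ is of order $n_j\times n_j$ when $\epsilon=1$, and $\mathfrak{E}_j=\mathrm{diag}(\pm1,\dots,\pm1)$ is of order $n_j\times n_j$ when $\epsilon=-1$ (for some choice of the signs).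
   Context: $\epsilon\in\{1,-1\}$; $H$ is conjugate transpose, ${\rm i}$ the imaginary unit; $B^{-H}=(B^{-1})^H$. Standard pair: $(X,J)\in\mathbb{C}^{n\times 2n}\times\mathbb{C}^{2n\times 2n}$ is a standard pair of $P(\lambda)=\lambda^2A+\lambda Q+\epsilon A^H$ if $\begin{bmatrix}X\\ XJ\end{bmatrix}$ is nonsingular and $AXJ^2+QXJ+\epsilon A^HX=0$. For nonsingular $B\in\mathbb{C}^{m\times m}$, $\mathcal{S}_{(B,H,\epsilon)}=\{S\in\mathbb{C}^{m\times m}:S^H=-\epsilon S,\ BS=SB^{-H}\}$. The matrix corresponding to a standard pair $(Y,J)$ of $P(\lambda)$ is $\Gamma=\left([Y^H,\ J^{-H}Y^H]\begin{bmatrix}Q&A\\ A&0\end{bmatrix}\begin{bmatrix}Y\\ YJ\end{bmatrix}\right)^{-1}$; it satisfies $Y\Gamma Y^H=0$, $A=(YJ\Gamma Y^H)^{-1}$, $Q=-AYJ^2\Gamma Y^HA$. An eigenvalue is semi-simple if its algebraic multiplicity equals its geometric multiplicity. Form of $J$: $N_j$ denotes an $n_j\times n_j$ nilpotent matrix with ones or zeros along its superdiagonal and zeros elsewhere (all $N_j=0$ in the semi-simple case). $J=\mathrm{diag}(J_1,\dots,J_r)\in\mathbb{C}^{2n\times 2n}$, where different $J_j$ have no common eigenvalue and - for $j=1,\dots,l$: $J_j=\mathrm{diag}(\lambda_jI_{n_j}+N_j,\ \tfrac1{\bar\lambda_j}I_{n_j}+N_j)$, $\lambda_j\in\mathbb{C}$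 nonzero, $|\lambda_j|\ne1$; - for $j=l+1,\dots,r$: $J_j=\lambda_jI_{n_j}+N_j$, $|\lambda_j|=1$, with $2(n_1+\cdots+n_l)+n_{l+1}+\cdots+n_r=2n$. $X=[X_1,\dots,X_r]\in\mathbb{C}^{n\times 2n}$ is partitioned conformably; the columns of $X_j$ are the generalized eigenvectors belonging to $J_j$. *)

theory Defs
  imports
    "Jordan_Normal_Form.Schur_Decomposition"
    "Jordan_Normal_Form.Spectral_Radius"
    "Jordan_Normal_Form.Gauss_Jordan_Elimination"
    "Jordan_Normal_Form.Matrix_Kernel"
begin

(* Unspecified if A is singular; every use below is on a matrix that the standing
   hypotheses make nonsingular. *)
definition mat_inv :: "complex mat \<Rightarrow> complex mat" where
  "mat_inv A = the (mat_inverse A)"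

(* [A, B]; the library has only vertical concatenation *)
definition append_columns :: "complex mat \<Rightarrow> complex mat \<Rightarrow> complex mat" where
  "append_columns A B =
     four_block_mat A B (0\<^sub>m 0 (dim_col A)) (0\<^sub>m 0 (dim_col B))"

(* P(lambda) = lambda^2 A + lambda Q + eps A^H, as a matrix over the polynomial ring *)
definition pal_poly :: "complex \<Rightarrow> complex mat \<Rightarrow> complex mat \<Rightarrow> complex poly mat" where
  "pal_poly \<epsilon> A Q =
     map_mat (\<lambda>a. monom a 2) A + map_mat (\<lambda>q. monom q 1) Q
       + map_mat (\<lambda>c. monom c 0) (\<epsilon> \<cdot>\<^sub>m mat_adjoint A)"

definition polymat_eval :: "complex poly mat \<Rightarrow> complex \<Rightarrow> complex mat" where
  "polymat_eval P z = map_mat (\<lambda>p. poly p z) P"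

(* For regular P, i.e. det P not identically zero. *)
definition polymat_eigenvalue :: "complex poly mat \<Rightarrow> complex \<Rightarrow> bool" where
  "polymat_eigenvalue P z \<longleftrightarrow> poly (det P) z = 0"

(* algebraic multiplicity (order as a zero of det P) = geometric multiplicity (dim ker P(z)) *)
definition semisimple_eigenvalue :: "complex poly mat \<Rightarrow> complex \<Rightarrow> bool" where
  "semisimple_eigenvalue P z \<longleftrightarrow>
     polymat_eigenvalue P z \<and> Polynomial.order z (det P) = kernel_dim (polymat_eval P z)"

definition standard_pair ::
  "nat \<Rightarrow> complex \<Rightarrow> complex mat \<Rightarrow> complex mat \<Rightarrow> complex mat \<Rightarrow> complex mat \<Rightarrow> bool" where
  "standard_pair n \<epsilon> A Q X J \<longleftrightarrow>
     X \<in> carrier_mat n (2 * n) \<and> J \<in> carrier_mat (2 * n) (2 * n) \<and>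
     invertible_mat (X @\<^sub>r (X * J)) \<and>
     A * X * (J * J) + Q * X * J + \<epsilon> \<cdot>\<^sub>m (mat_adjoint A * X) = 0\<^sub>m n (2 * n)"

(* the matrix Gamma corresponding to a standard pair (Y, J) *)
definition Gamma_mat :: "complex mat \<Rightarrow> complex mat \<Rightarrow> complex mat \<Rightarrow> complex mat \<Rightarrow> complex mat" where
  "Gamma_mat A Q Y J =
     mat_inv (append_columns (mat_adjoint Y) (mat_adjoint (mat_inv J) * mat_adjoint Y)
       * four_block_mat Q A A (0\<^sub>m (dim_row A) (dim_col A))
       * (Y @\<^sub>r (Y * J)))"

(* S_(B,H,eps); intended for nonsingular square B *)
definition S_set :: "complex mat \<Rightarrow> complex \<Rightarrow> complex mat set" where
  "S_set B \<epsilon> = {S \<in> carrier_mat (dim_row B) (dim_row B).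
     mat_adjoint S = (- \<epsilon>) \<cdot>\<^sub>m S \<and> B * S = S * mat_adjoint (mat_inv B)}"

(* m x m, ones or zeros on the superdiagonal and zeros elsewhere; such N is automatically
   nilpotent *)
definition superdiag_nilpotent :: "nat \<Rightarrow> complex mat \<Rightarrow> bool" where
  "superdiag_nilpotent m N \<longleftrightarrow> N \<in> carrier_mat m m \<and>
     (\<forall>i<m. \<forall>k<m. if k = Suc i then N $$ (i, k) \<in> {0, 1} else N $$ (i, k) = 0)"

(* Blocks are indexed by 1, ..., r; the first l of them are the paired ones. *)
definition J_block :: "nat \<Rightarrow> (nat \<Rightarrow> complex) \<Rightarrow> (nat \<Rightarrow> nat) \<Rightarrow> (nat \<Rightarrow> complex mat) \<Rightarrow> nat \<Rightarrow> complex mat" where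
  "J_block l ev m N j =
     (if j \<le> l
      then diag_block_mat [ev j \<cdot>\<^sub>m 1\<^sub>m (m j) + N j, (1 / cnj (ev j)) \<cdot>\<^sub>m 1\<^sub>m (m j) + N j]
      else ev j \<cdot>\<^sub>m 1\<^sub>m (m j) + N j)"

definition jordan_form ::
  "nat \<Rightarrow> nat \<Rightarrow> nat \<Rightarrow> (nat \<Rightarrow> complex) \<Rightarrow> (nat \<Rightarrow> nat) \<Rightarrow> (nat \<Rightarrow> complex mat) \<Rightarrow> complex mat \<Rightarrow> bool" where
  "jordan_form n l r ev m N J \<longleftrightarrow>
     l \<le> r \<and>
     (\<forall>j\<in>{1..r}. 1 \<le> m j \<and> superdiag_nilpotent (m j) (N j)) \<and>
     (\<forall>j\<in>{1..l}. ev j \<noteq> 0 \<and> cmod (ev j) \<noteq> 1) \<and>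
     (\<forall>j\<in>{l+1..r}. cmod (ev j) = 1) \<and>
     (\<forall>i\<in>{1..r}. \<forall>j\<in>{1..r}. i \<noteq> j \<longrightarrow>
        spectrum (J_block l ev m N i) \<inter> spectrum (J_block l ev m N j) = {}) \<and>
     2 * (\<Sum>j=1..l. m j) + (\<Sum>j=l+1..r. m j) = 2 * n \<and>
     J = diag_block_mat (map (J_block l ev m N) [1..<Suc r])"

definition sign_diag :: "complex \<Rightarrow> nat \<Rightarrow> complex mat \<Rightarrow> bool" where
  "sign_diag \<epsilon> k E \<longleftrightarrow> E \<in> carrier_mat k k \<and> diagonal_mat E \<and>
     (\<forall>i<k. E $$ (i, i) \<in> (if \<epsilon> = 1 then {\<i>, - \<i>} else {1, - 1}))"

end

theory Submission
  imports Defs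
begin

text \<open>
  Let (X, J) be a standard pair and let M be the inverse of the matrix corresponding to it. Two
  facts about M drive everything. First, the equation A X J^2 + Q X J + \<epsilon> A^H X = 0 and
  Q^H = \<epsilon> Q give M^H = - \<epsilon> M and J^H M J = M (\<open>coupling_symmetry\<close>): M is an \<epsilon>-skew form that
  J preserves. Second, for every invertible C that commutes with J, (X C, J) is again a standard
  pair, and its form is the congruent matrix C^H M C (\<open>standard_pair_change\<close>,
  \<open>coupling_change_of_pair\<close>). So the claim is that M has the stated normal form under congruences
  that commute with J.

  Semi-simplicity makes J diagonal. A nonzero nilpotent part of J would give vectors u0, u1 with
  u0 \<noteq> 0, P(z) u0 = 0 and P(z) u1 + P'(z) u0 = 0. Let k be the dimension of the kernel of P(z). Row
  operations make k rows of P vanish at z, and a column operation by u0 + (\<lambda> - z) u1 makes one column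
  vanish at z to second order; hence det P vanishes at z to order at least k + 1, one more than
  semi-simplicity permits (\<open>chain_increases_order\<close>).

  For diagonal J with entries d_a the identity J^H M J = M reads conj(d_a) d_b M_ab = M_ab, so M_ab
  vanishes unless d_b = 1 / conj(d_a). As different blocks have no common eigenvalue, M is block
  diagonal with the blocks of J (\<open>diagonal_intertwiner_zero\<close>, \<open>simultaneous_normal_form\<close>). The block
  of M at the eigenvalues \<lambda> and 1 / conj(\<lambda>) off the unit circle is [0, K; - \<epsilon> K^H, 0] with K invertible,
  and diag(I, - \<epsilon> K^{-1}) normalises it (\<open>reciprocal_pair_normal_form\<close>). The block of M at an eigenvalue
  on the unit circle is Hermitian, up to the factor i when \<epsilon> = 1; there J is a scalar, every C commutes
  with it, and a diagonal matrix of signs is reached as in Sylvester's law of inertia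
  (\<open>unimodular_block_normal_form\<close>).
\<close>

section \<open>Adjoints, products and inverses\<close>

abbreviation conj_transpose :: "complex mat \<Rightarrow> complex mat"  ("_\<^sup>H" [1000] 999) where
  "A\<^sup>H \<equiv> mat_adjoint A"

lemma dim_adjoint [simp]: "dim_row (A\<^sup>H) = dim_col A" "dim_col (A\<^sup>H) = dim_row A"
  by (auto simp: mat_adjoint_def)

lemma adjoint_carrier [simp, intro]: "A \<in> carrier_mat n m \<Longrightarrow> A\<^sup>H \<in> carrier_mat m n"
  by (rule carrier_matI) auto

lemma index_adjoint [simp]:
  "i < dim_col A \<Longrightarrow> j < dim_row A \<Longrightarrow> A\<^sup>H $$ (i, j) = cnj (A $$ (j, i))"
  by (simp add: mat_adjoint_def mat_of_rows_index)

lemma adjoint_adjoint [simp]: "(A\<^sup>H)\<^sup>H = A"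
  by (rule eq_matI) auto

lemma adjoint_one [simp]: "(1\<^sub>m n)\<^sup>H = 1\<^sub>m n"
  by (rule eq_matI) auto

lemma adjoint_zero [simp]: "(0\<^sub>m n m)\<^sup>H = 0\<^sub>m m n"
  by (rule eq_matI) auto

lemma adjoint_smult: "(c \<cdot>\<^sub>m A)\<^sup>H = cnj c \<cdot>\<^sub>m A\<^sup>H"
  by (rule eq_matI) auto

lemma adjoint_add:
  "dim_row A = dim_row B \<Longrightarrow> dim_col A = dim_col B \<Longrightarrow> (A + B)\<^sup>H = A\<^sup>H + B\<^sup>H"
  by (rule eq_matI) auto

lemma adjoint_mult:
  assumes "dim_col A = dim_row B"
  shows "(A * B)\<^sup>H = B\<^sup>H * A\<^sup>H"
proof (rule eq_matI)
  fix i j assume "i < dim_row (B\<^sup>H * A\<^sup>H)" "j < dim_col (B\<^sup>H * A\<^sup>H)"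
  then have ij: "i < dim_col B" "j < dim_row A" by auto
  then show "(A * B)\<^sup>H $$ (i, j) = (B\<^sup>H * A\<^sup>H) $$ (i, j)"
    using assms by (auto simp: scalar_prod_def mult.commute intro!: sum.cong)
qed auto

lemma det_adjoint:
  assumes "A \<in> carrier_mat n n"
  shows "det (A\<^sup>H) = cnj (det A)"
proof -
  interpret cnj_hom: comm_ring_hom cnj by unfold_locales auto
  have "A\<^sup>H = map_mat cnj (transpose_mat A)"
    by (rule eq_matI) auto
  then have "det (A\<^sup>H) = det (map_mat cnj (transpose_mat A))" by simp
  also have "\<dots> = cnj (det (transpose_mat A))" by (rule cnj_hom.hom_det)
  finally show ?thesis using det_transpose[OF assms] by simp
qed

text \<open>The algebraic laws below have equations between dimensions as premises instead of carrier
  membership. The simplifier can then discharge them without guessing the intermediate dimensions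
  of a product.\<close>

lemma mult_assoc_dim:
  fixes A B C :: "'a :: semiring_0 mat"
  shows "dim_col A = dim_row B \<Longrightarrow> dim_col B = dim_row C \<Longrightarrow> A * B * C = A * (B * C)"
  by (rule assoc_mult_mat[of _ "dim_row A" "dim_row B" _ "dim_row C" _ "dim_col C"]) auto

lemma mult_add_dim:
  fixes A B C :: "'a :: semiring_0 mat"
  shows "dim_col A = dim_row B \<Longrightarrow> dim_row B = dim_row C \<Longrightarrow> dim_col B = dim_col C
    \<Longrightarrow> A * (B + C) = A * B + A * C"
  by (rule mult_add_distrib_mat[of _ "dim_row A" "dim_row B" _ "dim_col C"]) auto

lemma add_mult_dim:
  fixes A B C :: "'a :: semiring_0 mat"
  shows "dim_col A = dim_row C \<Longrightarrow> dim_row A = dim_row B \<Longrightarrow> dim_col A = dim_col B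
    \<Longrightarrow> (A + B) * C = A * C + B * C"
  by (rule add_mult_distrib_mat[of _ "dim_row A" "dim_row C" _ _ "dim_col C"]) auto

lemma smult_mult_dim:
  fixes A B :: "'a :: comm_semiring_0 mat"
  shows "dim_col A = dim_row B \<Longrightarrow> (c \<cdot>\<^sub>m A) * B = c \<cdot>\<^sub>m (A * B)"
   "dim_col A = dim_row B \<Longrightarrow> A * (c \<cdot>\<^sub>m B) = c \<cdot>\<^sub>m (A * B)"
  by (rule eq_matI; auto simp: scalar_prod_def sum_distrib_left ac_simps)+

lemma mult_vec_dim:
  fixes A B :: "'a :: comm_semiring_0 mat"
  shows "dim_col A = dim_row B \<Longrightarrow> dim_col B = dim_vec v \<Longrightarrow> A * B *\<^sub>v v = A *\<^sub>v (B *\<^sub>v v)"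
    "dim_col A = dim_vec v \<Longrightarrow> dim_vec v = dim_vec w \<Longrightarrow> A *\<^sub>v (v + w) = A *\<^sub>v v + A *\<^sub>v w"
    "dim_col A = dim_vec v \<Longrightarrow> A *\<^sub>v (c \<cdot>\<^sub>v v) = c \<cdot>\<^sub>v (A *\<^sub>v v)"
    "dim_col A = dim_vec v \<Longrightarrow> (c \<cdot>\<^sub>m A) *\<^sub>v v = c \<cdot>\<^sub>v (A *\<^sub>v v)"
    "dim_row A = dim_row B \<Longrightarrow> dim_col A = dim_col B \<Longrightarrow> dim_col B = dim_vec v
      \<Longrightarrow> (A + B) *\<^sub>v v = A *\<^sub>v v + B *\<^sub>v v"
proof -
  show "dim_col A = dim_row B \<Longrightarrow> dim_col B = dim_vec v \<Longrightarrow> A * B *\<^sub>v v = A *\<^sub>v (B *\<^sub>v v)"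
    by (rule assoc_mult_mat_vec[of _ "dim_row A" "dim_row B" _ "dim_vec v"])
       (auto intro: carrier_matI carrier_vecI)
qed (auto simp: scalar_prod_def sum_distrib_left algebra_simps sum.distrib intro!: eq_vecI)

lemma index_mult_mat_sum:
  fixes A B :: "'a :: semiring_0 mat"
  assumes "A \<in> carrier_mat n m" "B \<in> carrier_mat m k" "i < n" "j < k"
  shows "(A * B) $$ (i, j) = (\<Sum>l=0..<m. A $$ (i, l) * B $$ (l, j))"
  using assms by (simp add: scalar_prod_def)

lemma mat_inv_eqI:
  assumes "A \<in> carrier_mat n n" "B \<in> carrier_mat n n" "A * B = 1\<^sub>m n"
  shows "mat_inv A = B"
proof (cases "mat_inverse A")
  case None
  have "B * A = 1\<^sub>m n" using mat_mult_left_right_inverse[OF assms] .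
  then have "A \<in> Units (ring_mat TYPE(complex) n undefined)"
    using assms by (auto simp: Units_def ring_mat_simps)
  then show ?thesis using mat_inverse(1)[OF assms(1) None, of undefined] by blast
next
  case (Some B')
  have B': "B' * A = 1\<^sub>m n" "B' \<in> carrier_mat n n"
    using mat_inverse(2)[OF assms(1) Some] by auto
  have "B' = B' * (A * B)" unfolding assms(3) using B' by simp
  also have "\<dots> = (B' * A) * B"
    by (rule mult_assoc_dim[symmetric]) (use B' assms in auto)
  also have "\<dots> = B" unfolding B'(1) using assms by simp
  finally show ?thesis by (simp add: mat_inv_def Some)
qed

lemma det_nonzero_right_inverse:
  fixes A :: "complex mat"
  assumes "A \<in> carrier_mat n n" "det A \<noteq> 0"
  obtains B where "B \<in> carrier_mat n n" "A * B = 1\<^sub>m n" "B * A = 1\<^sub>m n"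
  using det_non_zero_imp_unit[OF assms, of undefined]
  by (auto simp: Units_def ring_mat_simps)

lemma invertible_iff_det_nonzero:
  fixes A :: "complex mat"
  assumes A: "A \<in> carrier_mat n n"
  shows "invertible_mat A \<longleftrightarrow> det A \<noteq> 0"
proof
  assume "invertible_mat A"
  then obtain B where AB: "A * B = 1\<^sub>m n" and BA: "B * A = 1\<^sub>m (dim_row B)"
    using A by (auto simp: invertible_mat_def inverts_mat_def)
  have B: "B \<in> carrier_mat n n"
    using arg_cong[OF AB, of dim_col] arg_cong[OF BA, of dim_col] A by auto
  have "det A * det B = 1" using det_mult[OF A B] AB by simp
  then show "det A \<noteq> 0" by auto
next
  assume "det A \<noteq> 0"
  from det_nonzero_right_inverse[OF A this] obtain B where
    "B \<in> carrier_mat n n" "A * B = 1\<^sub>m n" "B * A = 1\<^sub>m n" .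
  then show "invertible_mat A"
    using A by (auto simp: invertible_mat_def inverts_mat_def)
qed

lemma det_nonzeroI:
  fixes A :: "complex mat"
  assumes "A \<in> carrier_mat n n"
    and "\<And>v. v \<in> carrier_vec n \<Longrightarrow> A *\<^sub>v v = 0\<^sub>v n \<Longrightarrow> v = 0\<^sub>v n"
  shows "det A \<noteq> 0"
  using det_0_iff_vec_prod_zero[OF assms(1)] assms(2) by auto

lemma det_nonzeroD:
  fixes A :: "complex mat"
  assumes "A \<in> carrier_mat n n" "det A \<noteq> 0" "v \<in> carrier_vec n" "A *\<^sub>v v = 0\<^sub>v n"
  shows "v = 0\<^sub>v n"
  using det_0_iff_vec_prod_zero[OF assms(1)] assms by auto

section \<open>Direct sums\<close>

definition direct_sum :: "complex mat \<Rightarrow> complex mat \<Rightarrow> complex mat"  (infixr "\<oplus>\<^sub>m" 64) where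
  "A \<oplus>\<^sub>m B = four_block_mat A (0\<^sub>m (dim_row A) (dim_col B)) (0\<^sub>m (dim_row B) (dim_col A)) B"

lemma dim_direct_sum [simp]:
  "dim_row (A \<oplus>\<^sub>m B) = dim_row A + dim_row B" "dim_col (A \<oplus>\<^sub>m B) = dim_col A + dim_col B"
  by (auto simp: direct_sum_def)

lemma direct_sum_carrier [intro]:
  "A \<in> carrier_mat a a' \<Longrightarrow> B \<in> carrier_mat b b' \<Longrightarrow> A \<oplus>\<^sub>m B \<in> carrier_mat (a + b) (a' + b')"
  by (auto intro!: carrier_matI)

text \<open>This turns statements about a list of diagonal blocks into inductions that treat one direct sum
  at a time.\<close>

lemma diag_block_mat_Cons: "diag_block_mat (A # As) = A \<oplus>\<^sub>m diag_block_mat As"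
  by (simp add: direct_sum_def Let_def)

lemma direct_sum_one: "1\<^sub>m a \<oplus>\<^sub>m 1\<^sub>m b = 1\<^sub>m (a + b)"
  by (simp add: direct_sum_def)

lemma direct_sum_adjoint: "(A \<oplus>\<^sub>m B)\<^sup>H = A\<^sup>H \<oplus>\<^sub>m B\<^sup>H"
  by (rule eq_matI) (auto simp: direct_sum_def)

lemma direct_sum_mult:
  assumes "dim_col A = dim_row A'" "dim_col B = dim_row B'"
  shows "(A \<oplus>\<^sub>m B) * (A' \<oplus>\<^sub>m B') = (A * A') \<oplus>\<^sub>m (B * B')"
  unfolding direct_sum_def
  by (subst mult_four_block_mat[of _ "dim_row A" "dim_col A" _ "dim_col B" _ "dim_row B" _ _ "dim_col A'" _ "dim_col B'"])
     (use assms in \<open>auto intro!: cong_four_block_mat\<close>)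

lemma direct_sum_smult: "c \<cdot>\<^sub>m (A \<oplus>\<^sub>m B) = (c \<cdot>\<^sub>m A) \<oplus>\<^sub>m (c \<cdot>\<^sub>m B)"
  by (rule eq_matI) (auto simp: direct_sum_def)

lemma det_direct_sum:
  assumes "A \<in> carrier_mat a a" "B \<in> carrier_mat b b"
  shows "det (A \<oplus>\<^sub>m B) = det A * det B"
  unfolding direct_sum_def using assms
  by (subst det_four_block_mat_lower_left_zero[of _ a _ b]) auto

lemma direct_sum_eqD:
  assumes eq: "A \<oplus>\<^sub>m B = A' \<oplus>\<^sub>m B'"
    and "A \<in> carrier_mat a a" "A' \<in> carrier_mat a a" "B \<in> carrier_mat b b" "B' \<in> carrier_mat b b"
  shows "A = A'" "B = B'"
proof -
  have e: "(A \<oplus>\<^sub>m B) $$ (i, j) = (A' \<oplus>\<^sub>m B') $$ (i, j)" for i j using eq by simp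
  show "A = A'" "B = B'"
  proof -
    show "A = A'"
    proof (rule eq_matI)
      fix i j assume "i < dim_row A'" "j < dim_col A'"
      then show "A $$ (i, j) = A' $$ (i, j)" using e[of i j] assms by (auto simp: direct_sum_def)
    qed (use assms in auto)
    show "B = B'"
    proof (rule eq_matI)
      fix i j assume "i < dim_row B'" "j < dim_col B'"
      then show "B $$ (i, j) = B' $$ (i, j)" using e[of "a + i" "a + j"] assms by (auto simp: direct_sum_def)
    qed (use assms in auto)
  qed
qed

section \<open>The sesquilinear form attached to a standard pair\<close>

lemma append_columns_adjoint:
  assumes "Y \<in> carrier_mat a k" "Z \<in> carrier_mat b k"
  shows "append_columns (Y\<^sup>H) (Z\<^sup>H) = (Y @\<^sub>r Z)\<^sup>H"
  using assms unfolding append_columns_def append_rows_def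
  by (intro eq_matI) auto

text \<open>The inverse of the matrix corresponding to the pair (Y, J), multiplied out; Ji stands for the
  inverse of J.\<close>

definition coupling :: "complex mat \<Rightarrow> complex mat \<Rightarrow> complex mat \<Rightarrow> complex mat \<Rightarrow> complex mat \<Rightarrow> complex mat" where
  "coupling A Q Y J Ji = Y\<^sup>H * Q * Y + Y\<^sup>H * A * Y * J + Ji\<^sup>H * (Y\<^sup>H * A * Y)"

lemma coupling_carrier:
  assumes "A \<in> carrier_mat n n" "Q \<in> carrier_mat n n" "Y \<in> carrier_mat n k"
    "J \<in> carrier_mat k k" "Ji \<in> carrier_mat k k"
  shows "coupling A Q Y J Ji \<in> carrier_mat k k"
  using assms unfolding coupling_def by auto

lemma coupling_product:
  assumes A: "A \<in> carrier_mat n n" and Q: "Q \<in> carrier_mat n n" and Y: "Y \<in> carrier_mat n k"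
    and J: "J \<in> carrier_mat k k" and Ji: "Ji \<in> carrier_mat k k"
  shows "append_columns (Y\<^sup>H) (Ji\<^sup>H * Y\<^sup>H) * four_block_mat Q A A (0\<^sub>m n n) * (Y @\<^sub>r (Y * J))
    = coupling A Q Y J Ji"
proof -
  have 1: "append_columns (Y\<^sup>H) (Ji\<^sup>H * Y\<^sup>H) * four_block_mat Q A A (0\<^sub>m n n)
    = four_block_mat (Y\<^sup>H * Q + Ji\<^sup>H * Y\<^sup>H * A) (Y\<^sup>H * A) (0\<^sub>m 0 n) (0\<^sub>m 0 n)"
    unfolding append_columns_def
    apply (subst mult_four_block_mat[of _ k n _ n _ 0 _ _ n _ n])
    using assms by auto
  have 2: "four_block_mat (Y\<^sup>H * Q + Ji\<^sup>H * Y\<^sup>H * A) (Y\<^sup>H * A) (0\<^sub>m 0 n) (0\<^sub>m 0 n) * (Y @\<^sub>r (Y * J))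
    = four_block_mat ((Y\<^sup>H * Q + Ji\<^sup>H * Y\<^sup>H * A) * Y + Y\<^sup>H * A * (Y * J)) (0\<^sub>m k 0) (0\<^sub>m 0 k) (0\<^sub>m 0 0)"
    unfolding append_rows_def
    apply (subst mult_four_block_mat[of _ k n _ n _ 0 _ _ k _ 0])
    using assms by (auto intro!: cong_four_block_mat)
  have 3: "four_block_mat D (0\<^sub>m k 0) (0\<^sub>m 0 k) (0\<^sub>m 0 0) = D" if "D \<in> carrier_mat k k" for D :: "complex mat"
    using that by (intro eq_matI) auto
  have "(Y\<^sup>H * Q + Ji\<^sup>H * Y\<^sup>H * A) * Y + Y\<^sup>H * A * (Y * J)
    = (Y\<^sup>H * Q * Y + Ji\<^sup>H * (Y\<^sup>H * A * Y)) + Y\<^sup>H * A * Y * J"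
    using assms by (simp add: add_mult_dim mult_assoc_dim)
  also have "\<dots> = coupling A Q Y J Ji"
    unfolding coupling_def using assms
    by (intro eq_matI) (auto simp: ac_simps)
  finally show ?thesis
    unfolding 1 2 using 3[OF coupling_carrier[OF assms]] by simp
qed

text \<open>Put a = Y^H A Y and q = Y^H Q Y. Multiplying the defining equation of a standard pair by Y^H from
  the left and by J^{-1} from the right gives a J + q = - \<epsilon> a^H J^{-1}, hence the form is
  J^{-H} a - \<epsilon> a^H J^{-1}. In this shape the first symmetry is visible; the second follows from the
  adjoint of the same equation.\<close>

lemma coupling_symmetry:
  assumes A: "A \<in> carrier_mat n n" and Q: "Q \<in> carrier_mat n n" and Y: "Y \<in> carrier_mat n k"
    and J: "J \<in> carrier_mat k k" and Ji: "Ji \<in> carrier_mat k k" and inv: "J * Ji = 1\<^sub>m k"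
    and eps: "\<epsilon> \<in> {1, - 1}" and Qe: "Q\<^sup>H = \<epsilon> \<cdot>\<^sub>m Q"
    and eq: "A * Y * (J * J) + Q * Y * J + \<epsilon> \<cdot>\<^sub>m (A\<^sup>H * Y) = 0\<^sub>m n k"
  shows "(coupling A Q Y J Ji)\<^sup>H = (- \<epsilon>) \<cdot>\<^sub>m coupling A Q Y J Ji"
    and "J\<^sup>H * coupling A Q Y J Ji * J = coupling A Q Y J Ji"
proof -
  let ?M = "coupling A Q Y J Ji"
  define a where "a = Y\<^sup>H * A * Y"
  define q where "q = Y\<^sup>H * Q * Y"
  have a: "a \<in> carrier_mat k k" and q: "q \<in> carrier_mat k k"
    using A Q Y by (auto simp: a_def q_def)
  note [simp] = carrier_matD[OF A] carrier_matD[OF Q] carrier_matD[OF Y] carrier_matD[OF J]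
    carrier_matD[OF Ji] carrier_matD[OF a] carrier_matD[OF q]
  have eps': "cnj \<epsilon> = \<epsilon>" "\<epsilon> * \<epsilon> = 1" using eps by auto
  have inv': "Ji * J = 1\<^sub>m k" using mat_mult_left_right_inverse[OF J Ji inv] .
  have invH: "Ji\<^sup>H * J\<^sup>H = 1\<^sub>m k" "J\<^sup>H * Ji\<^sup>H = 1\<^sub>m k"
    by (simp_all add: adjoint_mult[symmetric] inv inv')
  have M: "?M = q + a * J + Ji\<^sup>H * a" by (simp add: coupling_def a_def q_def)
  have Mc: "?M \<in> carrier_mat k k" by (rule coupling_carrier) fact+
  have aH: "a\<^sup>H = Y\<^sup>H * A\<^sup>H * Y" by (simp add: a_def adjoint_mult mult_assoc_dim)
  have qH: "q\<^sup>H = \<epsilon> \<cdot>\<^sub>m q" by (simp add: q_def adjoint_mult Qe mult_assoc_dim smult_mult_dim)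
  have "Y\<^sup>H * (A * Y * (J * J) + Q * Y * J + \<epsilon> \<cdot>\<^sub>m (A\<^sup>H * Y)) * Ji = 0\<^sub>m k k"
    unfolding eq using Y Ji by simp
  also have "Y\<^sup>H * (A * Y * (J * J) + Q * Y * J + \<epsilon> \<cdot>\<^sub>m (A\<^sup>H * Y)) * Ji
    = a * J + q + \<epsilon> \<cdot>\<^sub>m (a\<^sup>H * Ji)"
    unfolding aH unfolding a_def q_def
    by (simp add: mult_add_dim add_mult_dim smult_mult_dim mult_assoc_dim inv)
  finally have e1: "a * J + q + \<epsilon> \<cdot>\<^sub>m (a\<^sup>H * Ji) = 0\<^sub>m k k" .
  then have "(a * J + q + \<epsilon> \<cdot>\<^sub>m (a\<^sup>H * Ji))\<^sup>H = 0\<^sub>m k k" by simp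
  then have e2: "J\<^sup>H * a\<^sup>H + \<epsilon> \<cdot>\<^sub>m q + \<epsilon> \<cdot>\<^sub>m (Ji\<^sup>H * a) = 0\<^sub>m k k"
    by (simp add: adjoint_add adjoint_mult adjoint_smult qH eps')
  \<comment> \<open>the shape that displays the symmetry, from the equation multiplied by J^{-1}\<close>
  have M2: "?M = Ji\<^sup>H * a + (- \<epsilon>) \<cdot>\<^sub>m (a\<^sup>H * Ji)"
  proof (rule eq_matI)
    fix i j assume "i < dim_row (Ji\<^sup>H * a + (- \<epsilon>) \<cdot>\<^sub>m (a\<^sup>H * Ji))"
      "j < dim_col (Ji\<^sup>H * a + (- \<epsilon>) \<cdot>\<^sub>m (a\<^sup>H * Ji))"
    then have ij: "i < k" "j < k" by auto
    have "(a * J) $$ (i,j) + q $$ (i,j) + \<epsilon> * (a\<^sup>H * Ji) $$ (i,j) = 0"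
      using arg_cong[OF e1, of "\<lambda>m. m $$ (i,j)"] ij by (simp del: index_mult_mat(1))
    then show "?M $$ (i,j) = (Ji\<^sup>H * a + (- \<epsilon>) \<cdot>\<^sub>m (a\<^sup>H * Ji)) $$ (i,j)"
      unfolding M using ij by (simp del: index_mult_mat(1) add: algebra_simps add_eq_0_iff)
  qed (use Mc in auto)
  have MH: "?M\<^sup>H = a\<^sup>H * Ji + (- \<epsilon>) \<cdot>\<^sub>m (Ji\<^sup>H * a)"
    unfolding M2 by (simp add: adjoint_add adjoint_mult adjoint_smult eps')
  show "?M\<^sup>H = (- \<epsilon>) \<cdot>\<^sub>m ?M"
    unfolding MH unfolding M2 using eps'
    by (intro eq_matI) (auto simp del: index_mult_mat(1) simp add: algebra_simps)
  have "J\<^sup>H * ?M * J = a * J + (- \<epsilon>) \<cdot>\<^sub>m (J\<^sup>H * a\<^sup>H)"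
    unfolding M2 using invH
    by (simp add: mult_add_dim add_mult_dim smult_mult_dim mult_assoc_dim inv')
       (simp add: mult_assoc_dim[symmetric] invH)
  also have "\<dots> = ?M"
  proof (rule eq_matI)
    fix i j assume "i < dim_row ?M" "j < dim_col ?M"
    then have ij: "i < k" "j < k" using Mc by auto
    have "(J\<^sup>H * a\<^sup>H) $$ (i,j) + \<epsilon> * q $$ (i,j) + \<epsilon> * (Ji\<^sup>H * a) $$ (i,j) = 0"
      using arg_cong[OF e2, of "\<lambda>m. m $$ (i,j)"] ij by (simp del: index_mult_mat(1))
    then have "(J\<^sup>H * a\<^sup>H) $$ (i,j) = - \<epsilon> * (q $$ (i,j) + (Ji\<^sup>H * a) $$ (i,j))"
      by (simp add: algebra_simps add_eq_0_iff)
    then have "- \<epsilon> * (J\<^sup>H * a\<^sup>H) $$ (i,j) = (\<epsilon> * \<epsilon>) * (q $$ (i,j) + (Ji\<^sup>H * a) $$ (i,j))"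
      by simp
    then have "- \<epsilon> * (J\<^sup>H * a\<^sup>H) $$ (i,j) = q $$ (i,j) + (Ji\<^sup>H * a) $$ (i,j)"
      unfolding eps' by simp
    then show "(a * J + (- \<epsilon>) \<cdot>\<^sub>m (J\<^sup>H * a\<^sup>H)) $$ (i,j) = ?M $$ (i,j)"
      unfolding M using ij by (simp del: index_mult_mat(1) add: algebra_simps)
  qed (use Mc in auto)
  finally show "J\<^sup>H * ?M * J = ?M" .
qed

lemma append_rows_kernel:
  fixes Y Z :: "complex mat"
  assumes "Y \<in> carrier_mat a k" "Z \<in> carrier_mat b k" "v \<in> carrier_vec k"
  shows "(Y @\<^sub>r Z) *\<^sub>v v = 0\<^sub>v (a + b) \<longleftrightarrow> Y *\<^sub>v v = 0\<^sub>v a \<and> Z *\<^sub>v v = 0\<^sub>v b"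
proof -
  have z: "0\<^sub>v (a + b) = (0\<^sub>v a @\<^sub>v 0\<^sub>v b :: complex vec)" by (intro eq_vecI) auto
  show ?thesis
    unfolding mat_mult_append[OF assms] z
    by (rule append_vec_eq[of _ a]) (use assms in auto)
qed

lemma append_rows_mult:
  fixes Y Z C :: "complex mat"
  assumes "Y \<in> carrier_mat a k" "Z \<in> carrier_mat b k" "C \<in> carrier_mat k c"
  shows "(Y @\<^sub>r Z) * C = (Y * C) @\<^sub>r (Z * C)"
  using assms unfolding append_rows_def by (intro eq_matI) (auto simp: scalar_prod_def)

text \<open>The form is a product of three invertible factors. The left factor is the adjoint of the matrix
  with the rows Y and Y J^{-1}, and multiplying that matrix by J from the right exchanges the two
  halves of the matrix with the rows Y and Y J.\<close>

lemma coupling_det_nonzero: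
  assumes A: "A \<in> carrier_mat n n" and Q: "Q \<in> carrier_mat n n" and Y: "Y \<in> carrier_mat n (2 * n)"
    and J: "J \<in> carrier_mat (2 * n) (2 * n)" and Ji: "Ji \<in> carrier_mat (2 * n) (2 * n)"
    and inv: "J * Ji = 1\<^sub>m (2 * n)"
    and detA: "det A \<noteq> 0" and detV: "det (Y @\<^sub>r (Y * J)) \<noteq> 0"
  shows "det (coupling A Q Y J Ji) \<noteq> 0"
proof -
  have V: "Y @\<^sub>r (Y * J) \<in> carrier_mat (2*n) (2*n)"
    using carrier_append_rows[OF Y, of "Y * J" n] Y J by (simp add: mult_2)
  have W: "Y @\<^sub>r (Y * Ji) \<in> carrier_mat (2*n) (2*n)"
    using carrier_append_rows[OF Y, of "Y * Ji" n] Y Ji by (simp add: mult_2)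
  \<comment> \<open>a kernel vector v of the rows Y and Y J^{-1} makes J^{-1} v a kernel vector of the rows Y and Y J\<close>
  have detW: "det (Y @\<^sub>r (Y * Ji)) \<noteq> 0"
  proof (rule det_nonzeroI[OF W])
    fix v assume v: "v \<in> carrier_vec (2*n)" and "(Y @\<^sub>r (Y * Ji)) *\<^sub>v v = 0\<^sub>v (2*n)"
    then have v0: "Y *\<^sub>v v = 0\<^sub>v n" "(Y * Ji) *\<^sub>v v = 0\<^sub>v n"
      using append_rows_kernel[OF Y _ v, of "Y * Ji" n] Y Ji by (auto simp: mult_2)
    have JJv: "J *\<^sub>v (Ji *\<^sub>v v) = v"
      using assoc_mult_mat_vec[OF J Ji v] inv v by simp
    have "(Y @\<^sub>r (Y * J)) *\<^sub>v (Ji *\<^sub>v v) = 0\<^sub>v (n + n)"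
      by (subst append_rows_kernel[OF Y, of _ n])
         (use Y J Ji v v0 JJv in \<open>auto simp: assoc_mult_mat_vec[of _ n "2*n" _ "2*n"]\<close>)
    then have "Ji *\<^sub>v v = 0\<^sub>v (2*n)"
      using det_nonzeroD[OF V detV, of "Ji *\<^sub>v v"] Ji v by (auto simp: mult_2)
    then show "v = 0\<^sub>v (2*n)" using JJv J by auto
  qed
  have B: "four_block_mat Q A A (0\<^sub>m n n) \<in> carrier_mat (2*n) (2*n)"
    using four_block_carrier_mat[OF Q, of "0\<^sub>m n n" n n] by (simp add: mult_2)
  have S: "four_block_mat (0\<^sub>m n n) (1\<^sub>m n) (1\<^sub>m n) (0\<^sub>m n n) \<in> carrier_mat (2*n) (2*n)"
    using four_block_carrier_mat[of "0\<^sub>m n n" n n "0\<^sub>m n n" n n] by (simp add: mult_2)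
  \<comment> \<open>exchanging the two block columns makes the middle factor block triangular with A twice on the diagonal\<close>
  have "four_block_mat Q A A (0\<^sub>m n n) * four_block_mat (0\<^sub>m n n) (1\<^sub>m n) (1\<^sub>m n) (0\<^sub>m n n)
      = four_block_mat A Q (0\<^sub>m n n) A"
    by (subst mult_four_block_mat[of _ n n _ n _ n _ _ n _ n]) (use A Q in auto)
  then have "det (four_block_mat Q A A (0\<^sub>m n n)) * det (four_block_mat (0\<^sub>m n n) (1\<^sub>m n) (1\<^sub>m n) (0\<^sub>m n n))
      = det A * det A"
    using det_mult[OF B S] det_four_block_mat_lower_left_zero[OF A Q refl A] by simp
  then have detB: "det (four_block_mat Q A A (0\<^sub>m n n)) \<noteq> 0" using detA by auto
  have WH: "append_columns (Y\<^sup>H) (Ji\<^sup>H * Y\<^sup>H) = (Y @\<^sub>r (Y * Ji))\<^sup>H"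
    using append_columns_adjoint[OF Y, of "Y * Ji" n] Y Ji by (simp add: adjoint_mult)
  have "det (coupling A Q Y J Ji)
     = det ((Y @\<^sub>r (Y * Ji))\<^sup>H * four_block_mat Q A A (0\<^sub>m n n)) * det (Y @\<^sub>r (Y * J))"
    unfolding coupling_product[OF A Q Y J Ji, symmetric] WH
    by (rule det_mult[OF mult_carrier_mat[OF adjoint_carrier[OF W] B] V])
  also have "\<dots> = det ((Y @\<^sub>r (Y * Ji))\<^sup>H) * det (four_block_mat Q A A (0\<^sub>m n n)) * det (Y @\<^sub>r (Y * J))"
    by (subst det_mult[OF adjoint_carrier[OF W] B]) simp
  finally show ?thesis using detB detV detW det_adjoint[OF W] by simp
qed

lemma coupling_change_of_pair:
  assumes A: "A \<in> carrier_mat n n" and Q: "Q \<in> carrier_mat n n" and Y: "Y \<in> carrier_mat n k"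
    and J: "J \<in> carrier_mat k k" and Ji: "Ji \<in> carrier_mat k k" and inv: "J * Ji = 1\<^sub>m k"
    and C: "C \<in> carrier_mat k k" and comm: "C * J = J * C"
  shows "coupling A Q (Y * C) J Ji = C\<^sup>H * coupling A Q Y J Ji * C"
proof -
  note [simp] = carrier_matD[OF A] carrier_matD[OF Q] carrier_matD[OF Y] carrier_matD[OF J]
    carrier_matD[OF Ji] carrier_matD[OF C]
  have inv': "Ji * J = 1\<^sub>m k" using mat_mult_left_right_inverse[OF J Ji inv] .
  have "Ji * C = Ji * (C * (J * Ji))" using C unfolding inv by simp
  also have "\<dots> = Ji * (C * J) * Ji" by (simp add: mult_assoc_dim)
  also have "\<dots> = (Ji * J) * C * Ji" unfolding comm by (simp add: mult_assoc_dim)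
  also have "\<dots> = C * Ji" using C inv' by simp
  finally have "(Ji * C)\<^sup>H = (C * Ji)\<^sup>H" by simp
  then have cH: "C\<^sup>H * Ji\<^sup>H = Ji\<^sup>H * C\<^sup>H" by (simp add: adjoint_mult)
  have cHX: "C\<^sup>H * (Ji\<^sup>H * Z) = Ji\<^sup>H * (C\<^sup>H * Z)" if "dim_row Z = k" for Z
    using that cH by (simp add: mult_assoc_dim[symmetric])
  show ?thesis
    unfolding coupling_def
    by (simp add: adjoint_mult mult_add_dim add_mult_dim mult_assoc_dim cHX comm)
qed

lemma standard_pair_change:
  assumes sp: "standard_pair n \<epsilon> A Q X J" and A: "A \<in> carrier_mat n n" and Q: "Q \<in> carrier_mat n n"
    and C: "C \<in> carrier_mat (2*n) (2*n)" and comm: "C * J = J * C" and detC: "det C \<noteq> 0"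
  shows "standard_pair n \<epsilon> A Q (X * C) J"
proof -
  have X: "X \<in> carrier_mat n (2*n)" and J: "J \<in> carrier_mat (2*n) (2*n)"
    and inv: "invertible_mat (X @\<^sub>r (X * J))"
    and eq: "A * X * (J * J) + Q * X * J + \<epsilon> \<cdot>\<^sub>m (A\<^sup>H * X) = 0\<^sub>m n (2 * n)"
    using sp by (auto simp: standard_pair_def)
  note [simp] = carrier_matD[OF A] carrier_matD[OF Q] carrier_matD[OF X] carrier_matD[OF J]
    carrier_matD[OF C]
  have V: "X @\<^sub>r (X * J) \<in> carrier_mat (2*n) (2*n)"
    using carrier_append_rows[OF X, of "X * J" n] X J by (simp add: mult_2)
  have "(X @\<^sub>r (X * J)) * C = (X * C) @\<^sub>r (X * C * J)"
    using append_rows_mult[OF X, of "X * J" n C "2*n"] X J C comm by (simp add: mult_assoc_dim)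
  then have "det ((X * C) @\<^sub>r (X * C * J)) = det (X @\<^sub>r (X * J)) * det C"
    using det_mult[OF V C] by simp
  then have "det ((X * C) @\<^sub>r (X * C * J)) \<noteq> 0"
    using inv detC invertible_iff_det_nonzero[OF V] by simp
  moreover have "(X * C) @\<^sub>r (X * C * J) \<in> carrier_mat (2*n) (2*n)"
    using carrier_append_rows[of "X * C" n "2*n" "X * C * J" n] X J C by (simp add: mult_2)
  ultimately have 1: "invertible_mat ((X * C) @\<^sub>r (X * C * J))"
    using invertible_iff_det_nonzero by blast
  have commX: "C * (J * Z) = J * (C * Z)" if "dim_row Z = 2*n" for Z
    using that comm by (simp add: mult_assoc_dim[symmetric])
  have "A * (X * C) * (J * J) + Q * (X * C) * J + \<epsilon> \<cdot>\<^sub>m (A\<^sup>H * (X * C))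
    = (A * X * (J * J) + Q * X * J + \<epsilon> \<cdot>\<^sub>m (A\<^sup>H * X)) * C"
    by (simp add: add_mult_dim smult_mult_dim mult_assoc_dim commX comm)
  also have "\<dots> = 0\<^sub>m n (2*n)" unfolding eq using C by simp
  finally show ?thesis using 1 X J C by (auto simp: standard_pair_def)
qed

text \<open>Membership of the inverse G of M in the set is a restatement of the two symmetries of M.\<close>

lemma mem_S_setI:
  assumes J: "J \<in> carrier_mat k k" and Ji: "Ji \<in> carrier_mat k k" and JJi: "J * Ji = 1\<^sub>m k"
    and M: "M \<in> carrier_mat k k" and G: "G \<in> carrier_mat k k" and MG: "M * G = 1\<^sub>m k"
    and eps: "\<epsilon> \<in> {1, - 1}"
    and MH: "M\<^sup>H = (- \<epsilon>) \<cdot>\<^sub>m M" and inv: "J\<^sup>H * M * J = M"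
  shows "G \<in> S_set J \<epsilon>"
proof -
  note [simp] = carrier_matD[OF J] carrier_matD[OF Ji] carrier_matD[OF M] carrier_matD[OF G]
  have GM: "G * M = 1\<^sub>m k" by (rule mat_mult_left_right_inverse[OF M G MG])
  have eps': "\<epsilon> * \<epsilon> = 1" using eps by auto
  have "(M * G)\<^sup>H = 1\<^sub>m k" unfolding MG by simp
  then have 1: "(- \<epsilon>) \<cdot>\<^sub>m (G\<^sup>H * M) = 1\<^sub>m k" by (simp add: adjoint_mult MH smult_mult_dim)
  have "(- \<epsilon>) \<cdot>\<^sub>m G\<^sup>H = (- \<epsilon>) \<cdot>\<^sub>m (G\<^sup>H * (M * G))" unfolding MG using G by simp
  also have "\<dots> = ((- \<epsilon>) \<cdot>\<^sub>m (G\<^sup>H * M)) * G" by (simp add: smult_mult_dim mult_assoc_dim)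
  also have "\<dots> = G" unfolding 1 using G by simp
  finally have GG: "(- \<epsilon>) \<cdot>\<^sub>m G\<^sup>H = G" .
  have GH: "G\<^sup>H = (- \<epsilon>) \<cdot>\<^sub>m G"
    by (subst (2) GG[symmetric], rule eq_matI) (auto simp: mult.assoc[symmetric] eps')
  have "(J * Ji)\<^sup>H = 1\<^sub>m k" unfolding JJi by simp
  then have JH: "Ji\<^sup>H * J\<^sup>H = 1\<^sub>m k" by (simp add: adjoint_mult)
  have "M * J = (Ji\<^sup>H * J\<^sup>H) * M * J" unfolding JH using M by simp
  also have "\<dots> = Ji\<^sup>H * (J\<^sup>H * M * J)" by (simp add: mult_assoc_dim)
  also have "\<dots> = Ji\<^sup>H * M" unfolding inv ..
  finally have MJ: "M * J = Ji\<^sup>H * M" .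
  have "J * G = (G * M) * J * G" unfolding GM using J by simp
  also have "\<dots> = G * (M * J) * G" by (simp add: mult_assoc_dim)
  also have "\<dots> = G * Ji\<^sup>H * (M * G)" unfolding MJ by (simp add: mult_assoc_dim)
  also have "\<dots> = G * Ji\<^sup>H" unfolding MG using G Ji by simp
  finally show ?thesis
    using GH G mat_inv_eqI[OF J Ji JJi] by (simp add: S_set_def)
qed

section \<open>Semi-simplicity excludes Jordan chains\<close>

text \<open>Each term of the Leibniz expansion takes one entry from every row and one from every column, so
  it collects every row factor and every column factor exactly once.\<close>

lemma row_col_factors_dvd_det:
  fixes W :: "'a :: comm_ring_1 mat"
  assumes W: "W \<in> carrier_mat n n"
    and dvd: "\<And>i j. i < n \<Longrightarrow> j < n \<Longrightarrow> d i * e j dvd W $$ (i, j)"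
  shows "(\<Prod>i=0..<n. d i) * (\<Prod>j=0..<n. e j) dvd det W"
proof -
  have "(\<Prod>i=0..<n. d i) * (\<Prod>j=0..<n. e j) dvd signof p * (\<Prod>i=0..<n. W $$ (i, p i))"
    if p: "p permutes {0..<n}" for p
  proof -
    have "(\<Prod>j=0..<n. e j) = (\<Prod>i=0..<n. e (p i))"
      by (rule prod.permute[OF p, unfolded comp_def])
    then have "(\<Prod>i=0..<n. d i) * (\<Prod>j=0..<n. e j) = (\<Prod>i=0..<n. d i * e (p i))"
      by (simp add: prod.distrib)
    also have "\<dots> dvd (\<Prod>i=0..<n. W $$ (i, p i))"
      using p by (intro prod_dvd_prod dvd) (auto dest: permutes_in_image)
    finally show ?thesis by (rule dvd_mult)
  qed
  then show ?thesis unfolding det_def'[OF W] by (intro dvd_sum) auto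
qed

text \<open>Gauss-Jordan elimination, read as multiplication by an invertible matrix G: the rows without a
  pivot are zero, and their number is the dimension of the kernel.\<close>

lemma kernel_dim_zero_rows:
  fixes M :: "complex mat"
  assumes M: "M \<in> carrier_mat n n"
  obtains G Z where "G \<in> carrier_mat n n" "det G \<noteq> 0" "Z \<subseteq> {0..<n}" "card Z = kernel_dim M"
    "\<And>i j. i \<in> Z \<Longrightarrow> j < n \<Longrightarrow> (G * M) $$ (i, j) = 0"
proof -
  let ?B = "gauss_jordan_single M"
  from gauss_jordan_single[OF M refl]
  obtain P P' where B: "?B = P * M" "P' * P = 1\<^sub>m n" "P \<in> carrier_mat n n" "P' \<in> carrier_mat n n"
    "?B \<in> carrier_mat n n" "row_echelon_form ?B" by auto
  obtain f where "pivot_fun ?B f n" using B by (auto simp: row_echelon_form_def)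
  note len = pivot_positions(4)[OF B(5) this]
  define Z where "Z = {i. i < n \<and> row ?B i = 0\<^sub>v n}"
  have "Z \<union> {i. i < n \<and> row ?B i \<noteq> 0\<^sub>v n} = {0..<n}" by (auto simp: Z_def)
  then have "card Z + card {i. i < n \<and> row ?B i \<noteq> 0\<^sub>v n} = n"
    by (subst card_Un_disjoint[symmetric]) (auto simp: Z_def)
  then have card: "card Z = kernel_dim M"
    unfolding kernel_dim_code len using M by simp
  have "det P' * det P = 1" using det_mult[OF B(4,3)] B(2) by simp
  then have det: "det P \<noteq> 0" by auto
  have "(P * M) $$ (i, j) = 0" if "i \<in> Z" "j < n" for i j
  proof -
    have "(P * M) $$ (i, j) = row ?B i $ j"
      unfolding B(1)[symmetric] using that carrier_matD[OF B(5)] Z_def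
      by (intro index_row(1)[symmetric]) auto
    also have "row ?B i = 0\<^sub>v n" using that by (simp add: Z_def)
    also have "0\<^sub>v n $ j = (0 :: complex)" using that by simp
    finally show ?thesis .
  qed
  moreover have "Z \<subseteq> {0..<n}" by (auto simp: Z_def)
  ultimately show ?thesis using that[OF B(3) det _ card] by blast
qed

lemma det_polymat_eval: "poly (det P) z = det (polymat_eval P z)"
  unfolding polymat_eval_def 
  by (rule comm_ring_hom.hom_det[OF poly_hom.comm_ring_hom_axioms, symmetric])

lemma det_column_replaced:
  fixes u :: "complex vec"
  assumes u: "u \<in> carrier_vec n" and c: "c < n" "u $ c \<noteq> 0"
  shows "det (mat n n (\<lambda>(i, j). if j = c then u $ i else if i = j then 1 else 0)) \<noteq> 0"
    (is "det ?S \<noteq> 0")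
proof (rule det_nonzeroI)
  fix v assume v: "v \<in> carrier_vec n" and S0: "?S *\<^sub>v v = 0\<^sub>v n"
  have ent: "u $ i * v $ c + (if i = c then 0 else v $ i) = 0" if i: "i < n" for i
  proof -
    have "0 = (?S *\<^sub>v v) $ i" using S0 i by simp
    also have "\<dots> = (\<Sum>j=0..<n. (if j = c then u $ i else if i = j then 1 else 0) * v $ j)"
      using i v by (simp add: scalar_prod_def)
    also have "\<dots> = (\<Sum>j=0..<n. (if j = c then u $ i * v $ c else 0)
        + (if j = i then (if i = c then 0 else v $ i) else 0))"
      by (rule sum.cong) auto
    also have "\<dots> = u $ i * v $ c + (if i = c then 0 else v $ i)"
      using i c by (simp add: sum.distrib)
    finally show ?thesis by simp
  qed
  from ent[of c] c have "v $ c = 0" by simp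
  with ent have "v $ i = 0" if "i < n" for i using that by (cases "i = c") (fastforce split: if_splits)+
  then show "v = 0\<^sub>v n" using v by (intro eq_vecI) auto
qed simp

lemma pal_poly_carrier: "A \<in> carrier_mat n n \<Longrightarrow> Q \<in> carrier_mat n n \<Longrightarrow> pal_poly \<epsilon> A Q \<in> carrier_mat n n"
  by (auto simp: pal_poly_def)

lemma index_pal_poly:
  assumes "A \<in> carrier_mat n n" "Q \<in> carrier_mat n n" "i < n" "j < n"
  shows "pal_poly \<epsilon> A Q $$ (i, j) = [: \<epsilon> * cnj (A $$ (j, i)), Q $$ (i, j), A $$ (i, j) :]"
  using assms by (simp add: pal_poly_def monom_Suc monom_0 numeral_2_eq_2)

lemma polymat_eval_pal_poly:
  assumes "A \<in> carrier_mat n n" "Q \<in> carrier_mat n n"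
  shows "polymat_eval (pal_poly \<epsilon> A Q) z = (z * z) \<cdot>\<^sub>m A + z \<cdot>\<^sub>m Q + \<epsilon> \<cdot>\<^sub>m A\<^sup>H"
proof (rule eq_matI)
  fix i j assume "i < dim_row ((z * z) \<cdot>\<^sub>m A + z \<cdot>\<^sub>m Q + \<epsilon> \<cdot>\<^sub>m A\<^sup>H)"
    "j < dim_col ((z * z) \<cdot>\<^sub>m A + z \<cdot>\<^sub>m Q + \<epsilon> \<cdot>\<^sub>m A\<^sup>H)"
  then have ij: "i < n" "j < n" using assms by auto
  then show "polymat_eval (pal_poly \<epsilon> A Q) z $$ (i, j) = ((z * z) \<cdot>\<^sub>m A + z \<cdot>\<^sub>m Q + \<epsilon> \<cdot>\<^sub>m A\<^sup>H) $$ (i, j)"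
    using assms index_pal_poly[OF assms ij] pal_poly_carrier[OF assms, of \<epsilon>]
    by (simp add: polymat_eval_def algebra_simps)
qed (use assms in \<open>auto simp: polymat_eval_def pal_poly_def\<close>)

text \<open>The vectors u0 and u1 form a Jordan chain of length two of P at z. It forces the order of z as a
  zero of det P above the geometric multiplicity: in G P B, where G comes from elimination on P(z)
  and B is the identity matrix with one column replaced by u0 + (\<lambda> - z) u1, the factor \<lambda> - z can be
  taken out of as many rows as the kernel has dimensions, and after that once more out of the
  replaced column.\<close>

lemma chain_increases_order:
  assumes A: "A \<in> carrier_mat n n" and Q: "Q \<in> carrier_mat n n"
    and u0: "u0 \<in> carrier_vec n" "u0 \<noteq> 0\<^sub>v n" and u1: "u1 \<in> carrier_vec n"
    and e0: "((z * z) \<cdot>\<^sub>m A + z \<cdot>\<^sub>m Q + \<epsilon> \<cdot>\<^sub>m A\<^sup>H) *\<^sub>v u0 = 0\<^sub>v n"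
    and e1: "((z * z) \<cdot>\<^sub>m A + z \<cdot>\<^sub>m Q + \<epsilon> \<cdot>\<^sub>m A\<^sup>H) *\<^sub>v u1 + ((2 * z) \<cdot>\<^sub>m A + Q) *\<^sub>v u0 = 0\<^sub>v n"
    and regular: "det (pal_poly \<epsilon> A Q) \<noteq> 0"
  shows "kernel_dim (polymat_eval (pal_poly \<epsilon> A Q) z) < Polynomial.order z (det (pal_poly \<epsilon> A Q))"
proof -
  let ?P = "pal_poly \<epsilon> A Q" and ?x = "[:- z, 1:]"
  interpret const_hom: comm_ring_hom "\<lambda>c :: complex. [:c:]" by unfold_locales (auto simp: one_pCons)
  have P: "?P \<in> carrier_mat n n" by (rule pal_poly_carrier) fact+
  have Pz: "polymat_eval ?P z \<in> carrier_mat n n" using P by (simp add: polymat_eval_def)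
  obtain G Z where G: "G \<in> carrier_mat n n" "det G \<noteq> 0"
    and Z: "Z \<subseteq> {0..<n}" "card Z = kernel_dim (polymat_eval ?P z)"
    and GZ: "\<And>i j. i \<in> Z \<Longrightarrow> j < n \<Longrightarrow> (G * polymat_eval ?P z) $$ (i, j) = 0"
    by (rule kernel_dim_zero_rows[OF Pz]) blast
  obtain c where c: "c < n" "u0 $ c \<noteq> 0"
  proof -
    have "\<exists>c<n. u0 $ c \<noteq> 0"
    proof (rule ccontr)
      assume "\<not> ?thesis"
      then have "u0 = 0\<^sub>v n" using u0(1) by (intro eq_vecI) auto
      then show False using u0(2) by simp
    qed
    then show ?thesis using that by auto
  qed
  define G' where "G' = map_mat (\<lambda>c. [:c:]) G"
  define B where "B = mat n n (\<lambda>(i, j). if j = c then [:u0 $ i - z * u1 $ i, u1 $ i:]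
     else if i = j then 1 else 0)"
  have G': "G' \<in> carrier_mat n n" and B: "B \<in> carrier_mat n n"
    using G by (auto simp: G'_def B_def)
  have "polymat_eval B z = mat n n (\<lambda>(i, j). if j = c then u0 $ i else if i = j then 1 else 0)"
    unfolding polymat_eval_def B_def by (rule eq_matI) auto
  then have Bz: "poly (det B) z \<noteq> 0"
    using det_column_replaced[OF u0(1) c] by (simp add: det_polymat_eval)
  have detG': "det G' = [:det G:]" unfolding G'_def by (rule const_hom.hom_det)
  have GP: "G' * ?P \<in> carrier_mat n n" and W: "G' * ?P * B \<in> carrier_mat n n"
    using G' P B by auto
  have detW: "det (G' * ?P * B) = [:det G:] * det ?P * det B"
    using det_mult[OF GP B] det_mult[OF G' P] detG' by simp
  have row: "?x dvd (G' * ?P) $$ (i, j)" if "i \<in> Z" "j < n" for i j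
  proof -
    have i: "i < n" using that Z by auto
    have "poly ((G' * ?P) $$ (i, j)) z = (G * polymat_eval ?P z) $$ (i, j)"
      using i that G P by (simp add: G'_def polymat_eval_def scalar_prod_def poly_sum)
    then show ?thesis using GZ[OF that] by (simp add: poly_eq_0_iff_dvd)
  qed
  have col: "?x * ?x dvd (?P * B) $$ (i, c)" if i: "i < n" for i
  proof -
    \<comment> \<open>summed over j, ?s and ?t give row i of P(z) u0 and of P(z) u1 + P'(z) u0; they are the coefficients
      of order 0 and 1 in \<lambda> - z, and (\<lambda> - z)^2 times ?r is what remains\<close>
    let ?a = "\<lambda>j. A $$ (i, j)" and ?q = "\<lambda>j. Q $$ (i, j)" and ?b = "\<lambda>j. \<epsilon> * cnj (A $$ (j, i))"
    let ?r = "\<lambda>j. [: ?a j * u0 $ j + (2 * z * ?a j + ?q j) * u1 $ j - z * (?a j * u1 $ j), ?a j * u1 $ j :]"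
    let ?s = "\<lambda>j. (z * z * ?a j + z * ?q j + ?b j) * u0 $ j"
    let ?t = "\<lambda>j. (z * z * ?a j + z * ?q j + ?b j) * u1 $ j + (2 * z * ?a j + ?q j) * u0 $ j"
    have s0: "(\<Sum>j=0..<n. ?s j) = 0"
    proof -
      have "(\<Sum>j=0..<n. ?s j) = (((z * z) \<cdot>\<^sub>m A + z \<cdot>\<^sub>m Q + \<epsilon> \<cdot>\<^sub>m A\<^sup>H) *\<^sub>v u0) $ i"
        using i A Q u0 by (auto simp: scalar_prod_def intro!: sum.cong)
      then show ?thesis using e0 i by simp
    qed
    have t0: "(\<Sum>j=0..<n. ?t j) = 0"
    proof -
      have "(\<Sum>j=0..<n. ?t j) = (((z * z) \<cdot>\<^sub>m A + z \<cdot>\<^sub>m Q + \<epsilon> \<cdot>\<^sub>m A\<^sup>H) *\<^sub>v u1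
          + ((2 * z) \<cdot>\<^sub>m A + Q) *\<^sub>v u0) $ i"
        using i A Q u0 u1 by (auto simp: scalar_prod_def sum.distrib intro!: sum.cong)
      then show ?thesis using e1 i by simp
    qed
    have "(?P * B) $$ (i, c) = (\<Sum>j=0..<n. [:?b j, ?q j, ?a j:] * [:u0 $ j - z * u1 $ j, u1 $ j:])"
      using i c P index_pal_poly[OF A Q i] by (auto simp: scalar_prod_def B_def intro!: sum.cong)
    also have "\<dots> = (\<Sum>j=0..<n. ?x * ?x * ?r j + [:?s j:] + ?x * [:?t j:])"
      by (intro sum.cong refl) (simp add: algebra_simps)
    also have "\<dots> = ?x * ?x * (\<Sum>j=0..<n. ?r j) + [:\<Sum>j=0..<n. ?s j:] + ?x * [:\<Sum>j=0..<n. ?t j:]"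
      by (simp only: sum.distrib[of "\<lambda>j. ?x * ?x * ?r j + [:?s j:]"] sum.distrib[of "\<lambda>j. ?x * ?x * ?r j"]
          sum_distrib_left[symmetric] const_hom.hom_sum[symmetric])
    also have "\<dots> = ?x * ?x * (\<Sum>j=0..<n. ?r j)" unfolding s0 t0 by simp
    finally have "(?P * B) $$ (i, c) = ?x * ?x * (\<Sum>j=0..<n. ?r j)" .
    then show ?thesis by (rule dvdI)
  qed
  define d where "d i = (if i \<in> Z then ?x else 1)" for i
  define e where "e j = (if j = c then ?x else 1)" for j
  have "(\<Prod>i=0..<n. d i) * (\<Prod>j=0..<n. e j) dvd det (G' * ?P * B)"
  proof (rule row_col_factors_dvd_det[OF W])
    fix i j assume i: "i < n" and j: "j < n"
    show "d i * e j dvd (G' * ?P * B) $$ (i, j)"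
    proof (cases "j = c")
      case True
      have "G' * ?P * B = G' * (?P * B)" using G' P B by (rule assoc_mult_mat)
      then have "(G' * ?P * B) $$ (i, j) = (\<Sum>k=0..<n. G' $$ (i, k) * (?P * B) $$ (k, c))"
        using index_mult_mat_sum[OF G' mult_carrier_mat[OF P B] i j] True by simp
      also have "?x * ?x dvd \<dots>" by (intro dvd_sum dvd_mult col) auto
      finally have "?x * ?x dvd (G' * ?P * B) $$ (i, j)" .
      moreover have "d i * e j dvd ?x * ?x" using True
        by (auto simp: d_def e_def simp del: mult_pCons_left mult_pCons_right)
      ultimately show ?thesis by (rule dvd_trans[rotated])
    next
      case False
      then have "d i * e j = d i" by (simp add: e_def)
      moreover have "?x dvd (G' * ?P * B) $$ (i, j)" if "i \<in> Z"
      proof -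
        have "(G' * ?P * B) $$ (i, j) = (\<Sum>k=0..<n. (G' * ?P) $$ (i, k) * B $$ (k, j))"
          by (rule index_mult_mat_sum[OF GP B i j])
        also have "?x dvd \<dots>" by (intro dvd_sum dvd_mult2 row that) auto
        finally show ?thesis .
      qed
      ultimately show ?thesis by (auto simp: d_def)
    qed
  qed
  moreover have "(\<Prod>i=0..<n. d i) = ?x ^ card Z"
    unfolding d_def using Z by (subst prod.inter_restrict[symmetric]) (auto simp: Int_absorb1)
  moreover have "(\<Prod>j=0..<n. e j) = ?x"
    unfolding e_def using c by simp
  ultimately have dvd: "?x ^ Suc (card Z) dvd [:det G:] * det ?P * det B"
    unfolding detW by (simp add: mult.commute)
  have nz: "[:det G:] * det ?P * det B \<noteq> 0" using G regular Bz by auto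
  have "Suc (card Z) \<le> Polynomial.order z ([:det G:] * det ?P * det B)"
    using dvd nz order_divides by blast
  also have "\<dots> = Polynomial.order z (det ?P)"
  proof -
    have nz': "[:det G:] * det ?P \<noteq> 0" using nz by auto
    have "Polynomial.order z [:det G:] = 0" "Polynomial.order z (det B) = 0"
      using G Bz by (auto intro: order_0I)
    then show ?thesis unfolding order_mult[OF nz] order_mult[OF nz'] by simp
  qed
  finally show ?thesis using Z by simp
qed

text \<open>There is no Jordan chain of length two, that is, no nilpotent part. In this form the property
  passes to the blocks of a direct sum by padding vectors with zeros, with no count of multiplicities.\<close>

definition chain_free :: "complex mat \<Rightarrow> bool" where
  "chain_free J \<longleftrightarrow> (\<forall>z. \<forall>v\<in>carrier_vec (dim_row J). \<forall>w\<in>carrier_vec (dim_row J).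
     J *\<^sub>v v = z \<cdot>\<^sub>v v + w \<longrightarrow> J *\<^sub>v w = z \<cdot>\<^sub>v w \<longrightarrow> w = 0\<^sub>v (dim_row J))"

text \<open>If J v = z v + w and J w = z w, then u0 = X w and u1 = X v form a Jordan chain of length two of P at z,
  because   J^2 v = z^2 v + 2 z w turns the defining equation of the pair, applied to v, into
  P(z) u1 + P'(z) u0 = 0.\<close>

lemma semisimple_imp_chain_free:
  assumes A: "A \<in> carrier_mat n n" and Q: "Q \<in> carrier_mat n n" and detA: "det A \<noteq> 0"
    and eps: "\<epsilon> \<noteq> 0"
    and sp: "standard_pair n \<epsilon> A Q X J"
    and ss: "\<forall>z. polymat_eigenvalue (pal_poly \<epsilon> A Q) z \<longrightarrow> semisimple_eigenvalue (pal_poly \<epsilon> A Q) z"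
  shows "chain_free J"
proof -
  let ?P = "pal_poly \<epsilon> A Q"
  have X: "X \<in> carrier_mat n (2*n)" and J: "J \<in> carrier_mat (2*n) (2*n)"
    and inv: "invertible_mat (X @\<^sub>r (X * J))"
    and eq: "A * X * (J * J) + Q * X * J + \<epsilon> \<cdot>\<^sub>m (A\<^sup>H * X) = 0\<^sub>m n (2 * n)"
    using sp by (auto simp: standard_pair_def)
  have V: "X @\<^sub>r (X * J) \<in> carrier_mat (2*n) (2*n)"
    using carrier_append_rows[OF X, of "X * J" n] X J by (simp add: mult_2)
  have detV: "det (X @\<^sub>r (X * J)) \<noteq> 0" using inv invertible_iff_det_nonzero[OF V] by simp
  \<comment> \<open>evaluation at 0 shows that det P is not the zero polynomial, so that the order of its zeros is meaningful\<close>
  have "polymat_eval ?P 0 = \<epsilon> \<cdot>\<^sub>m A\<^sup>H"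
    unfolding polymat_eval_pal_poly[OF A Q] using A Q by (intro eq_matI) auto
  then have "poly (det ?P) 0 \<noteq> 0"
    unfolding det_polymat_eval using detA eps det_adjoint[OF A] A by simp
  then have regular: "det ?P \<noteq> 0" by auto
  show ?thesis unfolding chain_free_def
  proof (intro allI ballI impI)
    fix z v w assume "v \<in> carrier_vec (dim_row J)" "w \<in> carrier_vec (dim_row J)"
      and Jv: "J *\<^sub>v v = z \<cdot>\<^sub>v v + w" and Jw: "J *\<^sub>v w = z \<cdot>\<^sub>v w"
    then have v: "v \<in> carrier_vec (2*n)" and w: "w \<in> carrier_vec (2*n)" using J by auto
    let ?Pz = "(z * z) \<cdot>\<^sub>m A + z \<cdot>\<^sub>m Q + \<epsilon> \<cdot>\<^sub>m A\<^sup>H"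
    have Xv: "X *\<^sub>v v \<in> carrier_vec n" and Xw: "X *\<^sub>v w \<in> carrier_vec n" using X v w by auto
    have JJv: "J *\<^sub>v (J *\<^sub>v v) = (z * z) \<cdot>\<^sub>v v + (2 * z) \<cdot>\<^sub>v w"
    proof -
      have "J *\<^sub>v (J *\<^sub>v v) = z \<cdot>\<^sub>v (J *\<^sub>v v) + J *\<^sub>v w"
        unfolding Jv using J v w by (simp add: mult_add_distrib_mat_vec[of _ "2*n" "2*n"] mult_mat_vec[of _ "2*n" "2*n"] Jv)
      also have "\<dots> = (z * z) \<cdot>\<^sub>v v + (2 * z) \<cdot>\<^sub>v w"
        unfolding Jv Jw using v w by (intro eq_vecI) (auto simp: algebra_simps)
      finally show ?thesis .
    qed
    have JJw: "J *\<^sub>v (J *\<^sub>v w) = (z * z) \<cdot>\<^sub>v w"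
      unfolding Jw using J w by (simp add: mult_mat_vec[of _ "2*n" "2*n"] Jw smult_smult_assoc)
    have dims: "dim_row A = n" "dim_col A = n" "dim_row Q = n" "dim_col Q = n" "dim_row X = n"
      "dim_col X = 2 * n" "dim_row J = 2 * n" "dim_col J = 2 * n" "dim_vec v = 2 * n" "dim_vec w = 2 * n"
      using A Q X J v w by auto
    have apply_eq: "A *\<^sub>v (X *\<^sub>v (J *\<^sub>v (J *\<^sub>v y))) + Q *\<^sub>v (X *\<^sub>v (J *\<^sub>v y)) + \<epsilon> \<cdot>\<^sub>v (A\<^sup>H *\<^sub>v (X *\<^sub>v y)) = 0\<^sub>v n"
      if y: "y \<in> carrier_vec (2*n)" for y
    proof -
      have dy: "dim_vec y = 2 * n" using y by auto
      have "0\<^sub>v n = (A * X * (J * J) + Q * X * J + \<epsilon> \<cdot>\<^sub>m (A\<^sup>H * X)) *\<^sub>v y"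
        unfolding eq using y by auto
      also have "\<dots> = A *\<^sub>v (X *\<^sub>v (J *\<^sub>v (J *\<^sub>v y))) + Q *\<^sub>v (X *\<^sub>v (J *\<^sub>v y)) + \<epsilon> \<cdot>\<^sub>v (A\<^sup>H *\<^sub>v (X *\<^sub>v y))"
        by (simp add: mult_vec_dim dims dy)
      finally show ?thesis by simp
    qed
    have e0: "?Pz *\<^sub>v (X *\<^sub>v w) = 0\<^sub>v n"
    proof -
      have "?Pz *\<^sub>v (X *\<^sub>v w) = A *\<^sub>v (X *\<^sub>v (J *\<^sub>v (J *\<^sub>v w))) + Q *\<^sub>v (X *\<^sub>v (J *\<^sub>v w)) + \<epsilon> \<cdot>\<^sub>v (A\<^sup>H *\<^sub>v (X *\<^sub>v w))"
        unfolding JJw unfolding Jw by (simp add: mult_vec_dim dims)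
      then show ?thesis using apply_eq[OF w] by simp
    qed
    have e1: "?Pz *\<^sub>v (X *\<^sub>v v) + ((2 * z) \<cdot>\<^sub>m A + Q) *\<^sub>v (X *\<^sub>v w) = 0\<^sub>v n"
    proof -
      have "?Pz *\<^sub>v (X *\<^sub>v v) + ((2 * z) \<cdot>\<^sub>m A + Q) *\<^sub>v (X *\<^sub>v w)
        = A *\<^sub>v (X *\<^sub>v (J *\<^sub>v (J *\<^sub>v v))) + Q *\<^sub>v (X *\<^sub>v (J *\<^sub>v v)) + \<epsilon> \<cdot>\<^sub>v (A\<^sup>H *\<^sub>v (X *\<^sub>v v))"
        unfolding JJv unfolding Jv
        by (simp add: mult_vec_dim dims) (intro eq_vecI, auto simp: dims simp del: index_mult_mat_vec)
      then show ?thesis using apply_eq[OF v] by simp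
    qed
    show "w = 0\<^sub>v (dim_row J)"
    proof (rule ccontr)
      assume "w \<noteq> 0\<^sub>v (dim_row J)"
      then have w0: "w \<noteq> 0\<^sub>v (2*n)" using J by auto
      have u0: "X *\<^sub>v w \<noteq> 0\<^sub>v n"
      proof
        assume Xw0: "X *\<^sub>v w = 0\<^sub>v n"
        then have "(X * J) *\<^sub>v w = 0\<^sub>v n"
          by (simp add: mult_vec_dim dims Jw) (auto intro!: eq_vecI)
        then have "(X @\<^sub>r (X * J)) *\<^sub>v w = 0\<^sub>v (2*n)"
          using append_rows_kernel[OF X _ w, of "X * J" n] X J Xw0 by (auto simp: mult_2)
        then show False using det_nonzeroD[OF V detV w] w0 by simp
      qed
      have "kernel_dim (polymat_eval ?P z) < Polynomial.order z (det ?P)"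
        by (rule chain_increases_order[OF A Q Xw u0 Xv e0 e1 regular])
      moreover have "poly (det ?P) z = 0"
        using det_nonzeroD[of ?Pz n, OF _ _ Xw e0] u0 A Q
        unfolding det_polymat_eval polymat_eval_pal_poly[OF A Q] by auto
      ultimately show False using ss by (auto simp: polymat_eigenvalue_def semisimple_eigenvalue_def)
    qed
  qed
qed

lemma zero_mult_vec: "v \<in> carrier_vec m \<Longrightarrow> 0\<^sub>m k m *\<^sub>v v = (0\<^sub>v k :: complex vec)"
  by (intro eq_vecI) auto

lemma chain_free_direct_sum:
  assumes A: "A \<in> carrier_mat a a" and B: "B \<in> carrier_mat b b"
    and cf: "chain_free (A \<oplus>\<^sub>m B)" (is "chain_free ?J")
  shows "chain_free A" "chain_free B"
proof -
  have J: "?J *\<^sub>v (x @\<^sub>v y) = (A *\<^sub>v x) @\<^sub>v (B *\<^sub>v y)" if "x \<in> carrier_vec a" "y \<in> carrier_vec b" for x y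
    using that A B unfolding direct_sum_def
    by (subst four_block_mat_mult_vec[of _ a a _ b _ b]) (auto simp: zero_mult_vec)
  have app: "z \<cdot>\<^sub>v (x @\<^sub>v y) = (z \<cdot>\<^sub>v x) @\<^sub>v (z \<cdot>\<^sub>v y)" for z and x y :: "complex vec"
    by (intro eq_vecI) auto
  have plus: "(x @\<^sub>v y) + (x' @\<^sub>v y') = (x + x') @\<^sub>v (y + y')"
    if "x \<in> carrier_vec a" "x' \<in> carrier_vec a" "y \<in> carrier_vec b" "y' \<in> carrier_vec b" for x x' y y' :: "complex vec"
    using that by (intro eq_vecI) auto
  have zero: "0\<^sub>v (a + b) = (0\<^sub>v a @\<^sub>v 0\<^sub>v b :: complex vec)" by (intro eq_vecI) auto
  have dim: "dim_row ?J = a + b" "dim_row A = a" "dim_row B = b" using A B by auto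
  have main: "x' = 0\<^sub>v a \<and> y' = 0\<^sub>v b"
    if "x \<in> carrier_vec a" "x' \<in> carrier_vec a" "y \<in> carrier_vec b" "y' \<in> carrier_vec b"
      "A *\<^sub>v x = z \<cdot>\<^sub>v x + x'" "A *\<^sub>v x' = z \<cdot>\<^sub>v x'" "B *\<^sub>v y = z \<cdot>\<^sub>v y + y'" "B *\<^sub>v y' = z \<cdot>\<^sub>v y'"
    for z x x' y y'
  proof -
    have "x' @\<^sub>v y' = 0\<^sub>v (a + b)"
      using cf[unfolded chain_free_def dim, rule_format, of "x @\<^sub>v y" "x' @\<^sub>v y'" z] that
      by (simp add: J app plus)
    then show ?thesis unfolding zero using that by (subst (asm) append_vec_eq[of _ a]) auto
  qed
  have zz: "M *\<^sub>v 0\<^sub>v k = z \<cdot>\<^sub>v 0\<^sub>v k" "M *\<^sub>v 0\<^sub>v k = z \<cdot>\<^sub>v 0\<^sub>v k + 0\<^sub>v k"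
    if "M \<in> carrier_mat k k" for M :: "complex mat" and z k
    using that by (auto intro!: eq_vecI simp: scalar_prod_def)
  show "chain_free A" unfolding chain_free_def dim
    using main[of _ _ "0\<^sub>v b" "0\<^sub>v b"] zz[OF B] zero_carrier_vec[of b] by blast
  show "chain_free B" unfolding chain_free_def dim
    using main[of "0\<^sub>v a" "0\<^sub>v a"] zz[OF A] zero_carrier_vec[of a] by blast
qed

lemma diag_block_mat_square_carrier:
  "(\<And>B. B \<in> set Bs \<Longrightarrow> square_mat B) \<Longrightarrow>
   diag_block_mat Bs \<in> carrier_mat (dim_row (diag_block_mat Bs)) (dim_row (diag_block_mat Bs))"
  using diag_block_mat_square[of Bs] by (intro carrier_matI) auto

lemma chain_free_diag_block:
  assumes "chain_free (diag_block_mat Bs)" "\<And>B. B \<in> set Bs \<Longrightarrow> square_mat B" "B \<in> set Bs"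
  shows "chain_free B"
  using assms
proof (induction Bs)
  case (Cons C Bs)
  have C: "C \<in> carrier_mat (dim_row C) (dim_row C)" using Cons.prems(2)[of C] by auto
  have D: "diag_block_mat Bs \<in> carrier_mat (dim_row (diag_block_mat Bs)) (dim_row (diag_block_mat Bs))"
    using Cons.prems(2) by (intro diag_block_mat_square_carrier) auto
  note chain_free_direct_sum[OF C D Cons.prems(1)[unfolded diag_block_mat_Cons]]
  then show ?case using Cons by auto
qed simp

lemma mult_unit_vec:
  fixes A :: "complex mat"
  assumes "A \<in> carrier_mat m k" "i < k"
  shows "A *\<^sub>v unit_vec k i = col A i"
  using assms by (intro eq_vecI) (auto simp: scalar_prod_right_unit)

text \<open>At the first superdiagonal entry equal to 1 two consecutive unit vectors form a Jordan chain;
  minimality of the position is what makes the second of them an eigenvector.\<close>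

lemma chain_free_jordan_block:
  assumes N: "superdiag_nilpotent m N" and cf: "chain_free (c \<cdot>\<^sub>m 1\<^sub>m m + N)"
  shows "N = 0\<^sub>m m m"
proof (rule ccontr)
  assume "N \<noteq> 0\<^sub>m m m"
  have Nc: "N \<in> carrier_mat m m" using N by (simp add: superdiag_nilpotent_def)
  have off: "N $$ (i, k) = 0" if "i < m" "k < m" "k \<noteq> Suc i" for i k
    using N that by (auto simp: superdiag_nilpotent_def)
  have "\<exists>i. Suc i < m \<and> N $$ (i, Suc i) \<noteq> 0"
  proof (rule ccontr)
    assume *: "\<not> ?thesis"
    have "N = 0\<^sub>m m m"
    proof (rule eq_matI)
      fix i j assume "i < dim_row (0\<^sub>m m m :: complex mat)" "j < dim_col (0\<^sub>m m m :: complex mat)"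
      then show "N $$ (i, j) = 0\<^sub>m m m $$ (i, j)"
        using * off[of i j] by (cases "j = Suc i") auto
    qed (use Nc in auto)
    then show False using \<open>N \<noteq> 0\<^sub>m m m\<close> by simp
  qed
  then obtain i where i: "Suc i < m \<and> N $$ (i, Suc i) \<noteq> 0"
    and least: "\<And>k. k < i \<Longrightarrow> \<not> (Suc k < m \<and> N $$ (k, Suc k) \<noteq> 0)"
    using exists_least_iff[of "\<lambda>i. Suc i < m \<and> N $$ (i, Suc i) \<noteq> 0"] by blast
  have one: "N $$ (i, Suc i) = 1"
    using N[unfolded superdiag_nilpotent_def, THEN conjunct2, rule_format, of i "Suc i"] i by auto
  let ?J = "c \<cdot>\<^sub>m 1\<^sub>m m + N"
  have J: "?J \<in> carrier_mat m m" using Nc by auto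
  have 1: "?J *\<^sub>v unit_vec m (Suc i) = c \<cdot>\<^sub>v unit_vec m (Suc i) + unit_vec m i"
    using i J Nc one off[of _ "Suc i"] by (subst mult_unit_vec[OF J]) (auto intro!: eq_vecI)
  have "N $$ (k, i) = 0" if "k < m" for k
    using off[of k i] least[of k] that i by (cases "i = Suc k") auto
  then have 2: "?J *\<^sub>v unit_vec m i = c \<cdot>\<^sub>v unit_vec m i"
    using i J Nc by (subst mult_unit_vec[OF J]) (auto intro!: eq_vecI)
  have "unit_vec m i = (0\<^sub>v m :: complex vec)"
    using cf[unfolded chain_free_def, rule_format, of "unit_vec m (Suc i)" "unit_vec m i" c] 1 2 J by auto
  then show False using i arg_cong[of _ _ "\<lambda>v. v $ i"] by fastforce
qed

section \<open>Hermitian matrices up to congruence\<close>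

lemma orthogonal_completion:
  fixes v :: "complex vec"
  assumes v: "v \<in> carrier_vec n" "v \<noteq> 0\<^sub>v n" and n: "0 < n"
  obtains W where "W \<in> carrier_mat n n" "col W 0 = v" "corthogonal_mat W" "det W \<noteq> 0"
proof -
  interpret cof_vec_space n "TYPE(complex)" .
  define b where "b = basis_completion v"
  define ws where "ws = gram_schmidt n b"
  define W where "W = mat_of_cols n ws"
  from basis_completion[OF v, folded b_def]
  have b: "distinct b" "\<not> lin_dep (set b)" "set b \<subseteq> carrier_vec n" "hd b = v" "length b = n" by auto
  then obtain vs where bv: "b = v # vs" using n by (cases b) auto
  from gram_schmidt_result[OF b(3,1,2) refl, folded ws_def]
  have ws: "set ws \<subseteq> carrier_vec n" "corthogonal ws" "length ws = n" using b by auto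
  have hd: "hd ws = v" unfolding ws_def bv by (rule gram_schmidt_hd[OF v(1)])
  have W: "W \<in> carrier_mat n n"
    using ws unfolding W_def using mat_of_cols_carrier(1)[of n ws] by auto
  have orth: "corthogonal_mat W" unfolding W_def using orthogonal_mat_of_cols ws by auto
  have col: "col W 0 = v"
    using ws hd n v by (cases ws) (auto simp: W_def)
  have "corthogonal_inv W * W = 1\<^sub>m n"
    using corthogonal_inv_result[OF orth] W unfolding inverts_mat_def corthogonal_inv_def by auto
  moreover have "corthogonal_inv W \<in> carrier_mat n n"
    unfolding corthogonal_inv_def using W by (auto intro!: carrier_matI)
  ultimately have "det (corthogonal_inv W) * det W = 1"
    using det_mult[of "corthogonal_inv W" n W] W by simp
  then have "det W \<noteq> 0" by auto
  then show ?thesis using that W col orth by blast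
qed

lemma det_congruence:
  assumes "M \<in> carrier_mat n n" "C \<in> carrier_mat n n"
  shows "det (C\<^sup>H * M * C) = cnj (det C) * det M * det C"
  using det_mult[OF mult_carrier_mat[OF adjoint_carrier[OF assms(2)] assms(1)] assms(2)]
    det_mult[OF adjoint_carrier[OF assms(2)] assms(1)] det_adjoint[OF assms(2)] by simp

text \<open>Split off an eigenvector v of M. In a basis that completes v orthogonally, the first column of the
  congruent matrix vanishes below the diagonal, as M v is a multiple of v, and by symmetry so does
  the first row. The remaining block is handled by induction and the first diagonal entry is scaled
  to its sign.\<close>

lemma hermitian_sign_congruence:
  assumes "M \<in> carrier_mat m m" "M\<^sup>H = M" "det M \<noteq> 0"
  shows "\<exists>C D. C \<in> carrier_mat m m \<and> det C \<noteq> 0 \<and> sign_diag (- 1) m D \<and> C\<^sup>H * M * C = D"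
  using assms
proof (induction m arbitrary: M)
  case 0
  then show ?case
    by (intro exI[of _ "1\<^sub>m 0"] exI[of _ "M"]) (auto simp: sign_diag_def diagonal_mat_def intro!: eq_matI)
next
  case (Suc m M)
  note M = Suc.prems(1) and herm = Suc.prems(2) and det = Suc.prems(3)
  obtain e where "e \<in> spectrum M" using spectrum_non_empty[OF M] by auto
  then obtain v where v: "v \<in> carrier_vec (Suc m)" "v \<noteq> 0\<^sub>v (Suc m)" "M *\<^sub>v v = e \<cdot>\<^sub>v v"
    using M by (auto simp: spectrum_def eigenvalue_def eigenvector_def)
  obtain W where W: "W \<in> carrier_mat (Suc m) (Suc m)" "col W 0 = v" "corthogonal_mat W" "det W \<noteq> 0"
    using orthogonal_completion[OF v(1,2)] by blast
  define K where "K = W\<^sup>H * M * W"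
  have K: "K \<in> carrier_mat (Suc m) (Suc m)" using W M by (auto simp: K_def)
  have KH: "K\<^sup>H = K"
    using W M herm by (simp add: K_def adjoint_mult mult_assoc_dim)
  have detK: "det K \<noteq> 0"
    unfolding K_def det_congruence[OF M W(1)] using W det by simp
  have col0: "K $$ (i, 0) = 0" if i: "0 < i" "i < Suc m" for i
  proof -
    have "K $$ (i, 0) = col K 0 $ i" using K i by simp
    also have "col K 0 = W\<^sup>H *\<^sub>v (M *\<^sub>v v)"
      unfolding K_def using W(1,2) M v(1)
      by (subst col_mult2[of _ "Suc m" "Suc m"]) (auto simp: mult_vec_dim)
    also have "\<dots> = e \<cdot>\<^sub>v (W\<^sup>H *\<^sub>v v)"
      unfolding v(3) using W v by (simp add: mult_vec_dim)
    also have "\<dots> $ i = e * (W\<^sup>H *\<^sub>v v) $ i" using i W by simp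
    also have "(W\<^sup>H *\<^sub>v v) $ i = col W 0 \<bullet>c col W i"
      using W v i by (auto simp: scalar_prod_def mult.commute intro!: sum.cong)
    also have "\<dots> = 0" using corthogonal_matD[OF W(3), of 0 i] i W(1) by simp
    finally show ?thesis by simp
  qed
  have row0: "K $$ (0, i) = 0" if i: "0 < i" "i < Suc m" for i
  proof -
    have "K $$ (0, i) = K\<^sup>H $$ (0, i)" unfolding KH ..
    also have "\<dots> = 0" using i K col0[OF i] by simp
    finally show ?thesis .
  qed
  define a where "a = K $$ (0, 0)"
  define L where "L = mat m m (\<lambda>(i, j). K $$ (Suc i, Suc j))"
  have L: "L \<in> carrier_mat m m" by (simp add: L_def)
  let ?a = "mat 1 1 (\<lambda>_. a)"
  have K_split: "K = ?a \<oplus>\<^sub>m L"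
  proof (rule eq_matI)
    fix i j assume "i < dim_row (?a \<oplus>\<^sub>m L)" "j < dim_col (?a \<oplus>\<^sub>m L)"
    then have ij: "i < Suc m" "j < Suc m" using L by auto
    show "K $$ (i, j) = (?a \<oplus>\<^sub>m L) $$ (i, j)"
      using ij col0[of i] row0[of j]
      by (cases i; cases j) (auto simp: direct_sum_def L_def a_def)
  qed (use K L in auto)
  have "?a \<in> carrier_mat 1 1" by simp
  note split_det = det_direct_sum[OF this L, folded K_split]
  have LH: "L\<^sup>H = L" and aH: "?a\<^sup>H = ?a"
    using direct_sum_eqD[of "?a\<^sup>H" "L\<^sup>H" "?a" L 1 m] KH L
    unfolding K_split direct_sum_adjoint by auto
  have "cnj a = a" using arg_cong[OF aH, of "\<lambda>A. A $$ (0, 0)"] by simp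
  then obtain x where x: "a = complex_of_real x" by (metis Reals_cnj_iff Reals_cases)
  have "det ?a = a" by (simp add: det_single)
  then have x0: "x \<noteq> 0" and "det L \<noteq> 0" using detK x split_det by auto
  from Suc.IH[OF L LH this(2)] obtain C D where C: "C \<in> carrier_mat m m" "det C \<noteq> 0"
    and D: "sign_diag (- 1) m D" "C\<^sup>H * L * C = D" by blast
  \<comment> \<open>the scaling that turns the first diagonal entry x into its sign\<close>
  define t where "t = 1 / sqrt \<bar>x\<bar>"
  have t: "t * x * t = sgn x" and t0: "t \<noteq> 0"
    using x0 by (auto simp: t_def sgn_if field_simps)
  let ?c = "mat 1 1 (\<lambda>_. complex_of_real t)"
  let ?s = "mat 1 1 (\<lambda>_. complex_of_real (sgn x))"
  have s: "?c\<^sup>H * ?a * ?c = ?s"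
    by (intro eq_matI) (auto simp: scalar_prod_def x t[symmetric])
  let ?F = "?c \<oplus>\<^sub>m C"
  have F: "?F \<in> carrier_mat (Suc m) (Suc m)"
    using direct_sum_carrier[of ?c 1 1 C m m] C by simp
  have "?F\<^sup>H * K * ?F = ?s \<oplus>\<^sub>m D"
    unfolding K_split direct_sum_adjoint
    using C L D s by (simp add: direct_sum_mult)
  then have congr: "(W * ?F)\<^sup>H * M * (W * ?F) = ?s \<oplus>\<^sub>m D"
    using W(1) C(1) M by (simp add: K_def adjoint_mult mult_assoc_dim)
  have "det (W * ?F) \<noteq> 0"
    using det_mult[OF W(1) F] det_direct_sum[of ?c 1 C m] W C t0 by (simp add: det_single)
  moreover have "sign_diag (- 1) (Suc m) (?s \<oplus>\<^sub>m D)"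
  proof -
    have "(?s \<oplus>\<^sub>m D) $$ (i, i) \<in> {1, - 1}" if "i < Suc m" for i
      using that D(1) x0 by (cases i) (auto simp: sign_diag_def direct_sum_def sgn_if)
    moreover have "diagonal_mat (?s \<oplus>\<^sub>m D)"
      using D(1) by (auto simp: sign_diag_def direct_sum_def diagonal_mat_def)
    ultimately show ?thesis
      using D(1) direct_sum_carrier[of ?s 1 1 D m m] by (simp add: sign_diag_def)
  qed
  ultimately show ?case using mult_carrier_mat[OF W(1) F] congr by blast
qed

section \<open>Forms preserved by a diagonal matrix\<close>

text \<open>The set of permitted diagonal entries is kept explicit, because only these eigenvalues matter for
  the vanishing of off-diagonal blocks.\<close>

definition diagonal_in :: "complex set \<Rightarrow> nat \<Rightarrow> complex mat \<Rightarrow> bool" where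
  "diagonal_in S k D \<longleftrightarrow> D \<in> carrier_mat k k \<and>
     (\<forall>i<k. \<forall>j<k. i \<noteq> j \<longrightarrow> D $$ (i, j) = 0) \<and> (\<forall>i<k. D $$ (i, i) \<in> S)"

lemma diagonal_in_scalar: "c \<in> S \<Longrightarrow> diagonal_in S k (c \<cdot>\<^sub>m 1\<^sub>m k)"
  by (auto simp: diagonal_in_def)

lemma diagonal_in_mono: "diagonal_in S k D \<Longrightarrow> S \<subseteq> S' \<Longrightarrow> diagonal_in S' k D"
  by (auto simp: diagonal_in_def)

lemma diagonal_in_direct_sum:
  assumes "diagonal_in S a A" "diagonal_in S b B"
  shows "diagonal_in S (a + b) (A \<oplus>\<^sub>m B)"
  using assms direct_sum_carrier[of A a a B b b] by (auto simp: diagonal_in_def direct_sum_def)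

lemma diagonal_in_det_nonzero:
  assumes D: "diagonal_in S k D" and S: "0 \<notin> S"
  shows "det D \<noteq> 0"
proof -
  have Dc: "D \<in> carrier_mat k k" using D by (simp add: diagonal_in_def)
  have "upper_triangular D" using D by (auto simp: diagonal_in_def)
  moreover have "0 \<notin> set (diag_mat D)"
    using D S by (auto simp: diagonal_in_def diag_mat_def)
  ultimately show ?thesis
    using det_upper_triangular[OF _ Dc] by (simp add: prod_list_zero_iff)
qed

lemma diagonal_in_spectrum:
  assumes D: "diagonal_in S k D" and i: "i < k"
  shows "D $$ (i, i) \<in> spectrum D"
proof -
  have Dc: "D \<in> carrier_mat k k" using D by (simp add: diagonal_in_def)
  have "D *\<^sub>v unit_vec k i = D $$ (i, i) \<cdot>\<^sub>v unit_vec k i"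
    unfolding mult_unit_vec[OF Dc i] using D i
    by (intro eq_vecI) (auto simp: diagonal_in_def)
  moreover have "unit_vec k i \<noteq> (0\<^sub>v k :: complex vec)"
    using i unit_vec_nonzero by blast
  ultimately show ?thesis using Dc
    by (auto simp: spectrum_def eigenvalue_def eigenvector_def intro!: exI[of _ "unit_vec k i"])
qed

text \<open>Entrywise the equation says conj(s) t K_ij = K_ij with s and t taken from the two diagonals.\<close>

lemma diagonal_intertwiner_zero:
  assumes D1: "diagonal_in S1 a D1" and D2: "diagonal_in S2 b D2" and K: "K \<in> carrier_mat a b"
    and eq: "D1\<^sup>H * K * D2 = K"
    and ne: "\<And>s t. s \<in> S1 \<Longrightarrow> t \<in> S2 \<Longrightarrow> cnj s * t \<noteq> 1"
  shows "K = 0\<^sub>m a b"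
proof (rule eq_matI)
  fix i j assume "i < dim_row (0\<^sub>m a b :: complex mat)" "j < dim_col (0\<^sub>m a b :: complex mat)"
  then have i: "i < a" and j: "j < b" by auto
  have D1c: "D1 \<in> carrier_mat a a" and D2c: "D2 \<in> carrier_mat b b"
    using D1 D2 by (auto simp: diagonal_in_def)
  have left: "(D1\<^sup>H * K) $$ (i, l) = cnj (D1 $$ (i, i)) * K $$ (i, l)" if l: "l < b" for l
  proof -
    have "(D1\<^sup>H * K) $$ (i, l) = (\<Sum>k=0..<a. D1\<^sup>H $$ (i, k) * K $$ (k, l))"
      by (rule index_mult_mat_sum[OF adjoint_carrier[OF D1c] K i l])
    also have "\<dots> = (\<Sum>k=0..<a. if k = i then cnj (D1 $$ (i, i)) * K $$ (i, l) else 0)"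
      using D1 D1c i by (intro sum.cong) (auto simp: diagonal_in_def)
    finally show ?thesis using i by simp
  qed
  have "K $$ (i, j) = (D1\<^sup>H * K * D2) $$ (i, j)" unfolding eq ..
  also have "\<dots> = (\<Sum>l=0..<b. (D1\<^sup>H * K) $$ (i, l) * D2 $$ (l, j))"
    by (rule index_mult_mat_sum[OF mult_carrier_mat[OF adjoint_carrier[OF D1c] K] D2c i j])
  also have "\<dots> = (\<Sum>l=0..<b. if l = j then cnj (D1 $$ (i, i)) * K $$ (i, j) * D2 $$ (j, j) else 0)"
    using D2 j left by (intro sum.cong) (auto simp: diagonal_in_def)
  also have "\<dots> = (cnj (D1 $$ (i, i)) * D2 $$ (j, j)) * K $$ (i, j)"
    using j by simp
  finally have "(cnj (D1 $$ (i, i)) * D2 $$ (j, j) - 1) * K $$ (i, j) = 0"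
    by (simp add: algebra_simps)
  moreover have "cnj (D1 $$ (i, i)) * D2 $$ (j, j) \<noteq> 1"
    using D1 D2 i j by (intro ne) (auto simp: diagonal_in_def)
  ultimately show "K $$ (i, j) = 0\<^sub>m a b $$ (i, j)" using i j by simp
qed (use K in auto)

lemma invariant_form_blocks:
  assumes D1: "diagonal_in S1 a D1" and D2: "diagonal_in S2 b D2"
    and M: "M \<in> carrier_mat (a + b) (a + b)"
    and inv: "(D1 \<oplus>\<^sub>m D2)\<^sup>H * M * (D1 \<oplus>\<^sub>m D2) = M"
  obtains M11 M12 M21 M22 where
    "M = four_block_mat M11 M12 M21 M22"
    "M11 \<in> carrier_mat a a" "M12 \<in> carrier_mat a b" "M21 \<in> carrier_mat b a" "M22 \<in> carrier_mat b b"
    "D1\<^sup>H * M11 * D1 = M11" "D1\<^sup>H * M12 * D2 = M12" "D2\<^sup>H * M21 * D1 = M21" "D2\<^sup>H * M22 * D2 = M22"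
proof -
  obtain M11 M12 M21 M22 where sb: "split_block M a a = (M11, M12, M21, M22)"
    by (cases "split_block M a a") auto
  note s = split_block[OF sb, of b b]
  have c: "M11 \<in> carrier_mat a a" "M12 \<in> carrier_mat a b" "M21 \<in> carrier_mat b a" "M22 \<in> carrier_mat b b"
    and Meq: "M = four_block_mat M11 M12 M21 M22" using s M by auto
  have D: "D1 \<in> carrier_mat a a" "D2 \<in> carrier_mat b b" using D1 D2 by (auto simp: diagonal_in_def)
  have sum: "D1 \<oplus>\<^sub>m D2 = four_block_mat D1 (0\<^sub>m a b) (0\<^sub>m b a) D2"
    "D1\<^sup>H \<oplus>\<^sub>m D2\<^sup>H = four_block_mat (D1\<^sup>H) (0\<^sub>m a b) (0\<^sub>m b a) (D2\<^sup>H)"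
    using D by (auto simp: direct_sum_def)
  have "(D1\<^sup>H \<oplus>\<^sub>m D2\<^sup>H) * M = four_block_mat (D1\<^sup>H * M11) (D1\<^sup>H * M12) (D2\<^sup>H * M21) (D2\<^sup>H * M22)"
    unfolding sum Meq using c D
    by (subst mult_four_block_mat[of _ a a _ b _ b _ _ a _ b]) (auto intro!: cong_four_block_mat)
  then have "(D1\<^sup>H \<oplus>\<^sub>m D2\<^sup>H) * M * (D1 \<oplus>\<^sub>m D2)
     = four_block_mat (D1\<^sup>H * M11 * D1) (D1\<^sup>H * M12 * D2) (D2\<^sup>H * M21 * D1) (D2\<^sup>H * M22 * D2)"
    unfolding sum using c D
    by (simp, subst mult_four_block_mat[of _ a a _ b _ b _ _ a _ b]) (auto intro!: cong_four_block_mat)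
  then have eq: "four_block_mat (D1\<^sup>H * M11 * D1) (D1\<^sup>H * M12 * D2) (D2\<^sup>H * M21 * D1) (D2\<^sup>H * M22 * D2)
     = four_block_mat M11 M12 M21 M22" (is "?L = ?R")
    using inv unfolding direct_sum_adjoint Meq by simp
  have e: "?L $$ (i, j) = ?R $$ (i, j)" for i j using eq by simp
  have "D1\<^sup>H * M11 * D1 = M11"
  proof (rule eq_matI)
    fix i j assume "i < dim_row M11" "j < dim_col M11"
    then show "(D1\<^sup>H * M11 * D1) $$ (i, j) = M11 $$ (i, j)"
      using e[of i j] c D by (simp del: index_mult_mat(1))
  qed (use c D in auto)
  moreover have "D1\<^sup>H * M12 * D2 = M12"
  proof (rule eq_matI)
    fix i j assume "i < dim_row M12" "j < dim_col M12"
    then show "(D1\<^sup>H * M12 * D2) $$ (i, j) = M12 $$ (i, j)"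
      using e[of i "a + j"] c D by (simp del: index_mult_mat(1))
  qed (use c D in auto)
  moreover have "D2\<^sup>H * M21 * D1 = M21"
  proof (rule eq_matI)
    fix i j assume "i < dim_row M21" "j < dim_col M21"
    then show "(D2\<^sup>H * M21 * D1) $$ (i, j) = M21 $$ (i, j)"
      using e[of "a + i" j] c D by (simp del: index_mult_mat(1))
  qed (use c D in auto)
  moreover have "D2\<^sup>H * M22 * D2 = M22"
  proof (rule eq_matI)
    fix i j assume "i < dim_row M22" "j < dim_col M22"
    then show "(D2\<^sup>H * M22 * D2) $$ (i, j) = M22 $$ (i, j)"
      using e[of "a + i" "a + j"] c D by (simp del: index_mult_mat(1))
  qed (use c D in auto)
  ultimately show ?thesis using that Meq c by blast
qed

section \<open>Normal forms of the single blocks\<close>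

text \<open>With s = i for \<epsilon> = 1 and s = 1 for \<epsilon> = -1 the matrix s M is Hermitian, hence congruent to a
  diagonal matrix D of signs. Since D is its own inverse, the inverse of C^H M C = (1/s) D is s D.\<close>

lemma unimodular_block_normal_form:
  assumes M: "M \<in> carrier_mat k k" and eps: "\<epsilon> \<in> {1, - 1}"
    and MH: "M\<^sup>H = (- \<epsilon>) \<cdot>\<^sub>m M" and det: "det M \<noteq> 0"
  obtains C E where "C \<in> carrier_mat k k" "det C \<noteq> 0" "sign_diag \<epsilon> k E" "C\<^sup>H * M * C * E = 1\<^sub>m k"
proof -
  define s where "s = (if \<epsilon> = 1 then \<i> else 1)"
  have s: "s \<noteq> 0" by (simp add: s_def)
  have "(s \<cdot>\<^sub>m M)\<^sup>H = s \<cdot>\<^sub>m M"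
    unfolding adjoint_smult MH using eps by (intro eq_matI) (auto simp: s_def)
  moreover have "det (s \<cdot>\<^sub>m M) \<noteq> 0" using det s by simp
  ultimately obtain C D where C: "C \<in> carrier_mat k k" "det C \<noteq> 0"
    and D: "sign_diag (- 1) k D" and CD: "C\<^sup>H * (s \<cdot>\<^sub>m M) * C = D"
    using hermitian_sign_congruence[of "s \<cdot>\<^sub>m M" k] M by auto
  have Dc: "D \<in> carrier_mat k k" using D by (simp add: sign_diag_def)
  have "D * D = 1\<^sub>m k"
  proof (rule eq_matI)
    fix i j assume "i < dim_row (1\<^sub>m k :: complex mat)" "j < dim_col (1\<^sub>m k :: complex mat)"
    then have ij: "i < k" "j < k" by auto
    have "(D * D) $$ (i, j) = (\<Sum>l=0..<k. D $$ (i, l) * D $$ (l, j))"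
      by (rule index_mult_mat_sum[OF Dc Dc ij])
    also have "\<dots> = (\<Sum>l=0..<k. if l = i then (if i = j then 1 else 0) else 0)"
      using D ij by (intro sum.cong) (auto simp: sign_diag_def diagonal_mat_def)
    finally show "(D * D) $$ (i, j) = 1\<^sub>m k $$ (i, j)" using ij by simp
  qed (use Dc in auto)
  moreover have "C\<^sup>H * M * C * (s \<cdot>\<^sub>m D) = C\<^sup>H * (s \<cdot>\<^sub>m M) * C * D"
    using C M Dc by (simp add: smult_mult_dim mult_assoc_dim)
  ultimately have "C\<^sup>H * M * C * (s \<cdot>\<^sub>m D) = 1\<^sub>m k" unfolding CD by simp
  moreover have "sign_diag \<epsilon> k (s \<cdot>\<^sub>m D)"
    using D by (auto simp: sign_diag_def s_def diagonal_mat_def)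
  ultimately show ?thesis using that C by blast
qed

text \<open>As |z| \<noteq> 1, neither z nor 1 / conj(z) is coupled with itself, so both diagonal blocks of M vanish
  and M = [0, K; - \<epsilon> K^H, 0]. The transformation C = diag(I, - \<epsilon> K^{-1}) takes M to
  [0, - \<epsilon> I; I, 0], which is the inverse of the required block.\<close>

lemma reciprocal_pair_normal_form:
  assumes M: "M \<in> carrier_mat (k + k) (k + k)" and eps: "\<epsilon> \<in> {1, - 1}"
    and MH: "M\<^sup>H = (- \<epsilon>) \<cdot>\<^sub>m M" and det: "det M \<noteq> 0"
    and ev: "cmod z \<noteq> 1" "z \<noteq> 0"
    and inv: "((z \<cdot>\<^sub>m 1\<^sub>m k) \<oplus>\<^sub>m ((1 / cnj z) \<cdot>\<^sub>m 1\<^sub>m k))\<^sup>H * M * ((z \<cdot>\<^sub>m 1\<^sub>m k) \<oplus>\<^sub>m ((1 / cnj z) \<cdot>\<^sub>m 1\<^sub>m k)) = M"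
  obtains C where "C \<in> carrier_mat (k + k) (k + k)" "det C \<noteq> 0"
    "C * ((z \<cdot>\<^sub>m 1\<^sub>m k) \<oplus>\<^sub>m ((1 / cnj z) \<cdot>\<^sub>m 1\<^sub>m k)) = ((z \<cdot>\<^sub>m 1\<^sub>m k) \<oplus>\<^sub>m ((1 / cnj z) \<cdot>\<^sub>m 1\<^sub>m k)) * C"
    "C\<^sup>H * M * C * four_block_mat (0\<^sub>m k k) (1\<^sub>m k) ((- \<epsilon>) \<cdot>\<^sub>m 1\<^sub>m k) (0\<^sub>m k k) = 1\<^sub>m (k + k)"
proof -
  have D1: "diagonal_in {z} k (z \<cdot>\<^sub>m 1\<^sub>m k)" and D2: "diagonal_in {1 / cnj z} k ((1 / cnj z) \<cdot>\<^sub>m 1\<^sub>m k)"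
    by (auto intro: diagonal_in_scalar)
  obtain M11 M12 M21 M22 where Meq: "M = four_block_mat M11 M12 M21 M22"
    and c: "M11 \<in> carrier_mat k k" "M12 \<in> carrier_mat k k" "M21 \<in> carrier_mat k k" "M22 \<in> carrier_mat k k"
    and i1: "(z \<cdot>\<^sub>m 1\<^sub>m k)\<^sup>H * M11 * (z \<cdot>\<^sub>m 1\<^sub>m k) = M11"
    and i2: "((1 / cnj z) \<cdot>\<^sub>m 1\<^sub>m k)\<^sup>H * M22 * ((1 / cnj z) \<cdot>\<^sub>m 1\<^sub>m k) = M22"
    by (rule invariant_form_blocks[OF D1 D2 M inv]) blast
  have zz: "cnj z * z \<noteq> 1"
  proof
    assume "cnj z * z = 1"
    then have "cmod (cnj z * z) = 1" by simp
    then have "(cmod z)\<^sup>2 = 1" by (simp add: norm_mult power2_eq_square)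
    then show False using ev by (simp add: power2_eq_1_iff) (metis norm_ge_zero not_one_le_zero neg_0_le_iff_le zero_le_one order_trans)
  qed
  have "M11 = 0\<^sub>m k k"
    by (rule diagonal_intertwiner_zero[OF D1 D1 c(1) i1]) (use zz in auto)
  moreover have "cnj (1 / cnj z) * (1 / cnj z) \<noteq> 1"
  proof -
    have "cnj (1 / cnj z) * (1 / cnj z) = 1 / (cnj z * z)" by simp
    then show ?thesis using zz by (metis div_by_1 divide_divide_eq_right mult_1)
  qed
  then have "M22 = 0\<^sub>m k k"
    by (intro diagonal_intertwiner_zero[OF D2 D2 c(4) i2]) (metis singletonD)
  moreover have "M21 = (- \<epsilon>) \<cdot>\<^sub>m M12\<^sup>H"
  proof (rule eq_matI)
    fix i j assume "i < dim_row ((- \<epsilon>) \<cdot>\<^sub>m M12\<^sup>H)" "j < dim_col ((- \<epsilon>) \<cdot>\<^sub>m M12\<^sup>H)"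
    then have ij: "i < k" "j < k" using c by auto
    have "M\<^sup>H $$ (k + i, j) = - \<epsilon> * M $$ (k + i, j)" unfolding MH using ij M by simp
    then have "cnj (M12 $$ (j, i)) = - \<epsilon> * M21 $$ (i, j)"
      unfolding Meq using ij c by simp
    then have "- \<epsilon> * cnj (M12 $$ (j, i)) = (\<epsilon> * \<epsilon>) * M21 $$ (i, j)" by simp
    then show "M21 $$ (i, j) = ((- \<epsilon>) \<cdot>\<^sub>m M12\<^sup>H) $$ (i, j)" using ij c eps by auto
  qed (use c in auto)
  ultimately have M': "M = four_block_mat (0\<^sub>m k k) M12 ((- \<epsilon>) \<cdot>\<^sub>m M12\<^sup>H) (0\<^sub>m k k)"
    using Meq by simp
  have "det M12 \<noteq> 0"
  proof (rule det_nonzeroI[OF c(2)])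
    fix v assume v: "v \<in> carrier_vec k" "M12 *\<^sub>v v = 0\<^sub>v k"
    have "M *\<^sub>v (0\<^sub>v k @\<^sub>v v) = 0\<^sub>v (k + k)"
      unfolding M' using v c
      by (subst four_block_mat_mult_vec[of _ k k _ k _ k]) (auto simp: zero_mult_vec scalar_prod_def intro!: eq_vecI)
    then have "0\<^sub>v k @\<^sub>v v = 0\<^sub>v (k + k)"
      using det_nonzeroD[OF M det] v by auto
    also have "0\<^sub>v (k + k) = (0\<^sub>v k @\<^sub>v 0\<^sub>v k :: complex vec)" by (intro eq_vecI) auto
    finally show "v = 0\<^sub>v k" using v by (subst (asm) append_vec_eq[of _ k]) auto
  qed
  then obtain L where L: "L \<in> carrier_mat k k" "M12 * L = 1\<^sub>m k" "L * M12 = 1\<^sub>m k"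
    using det_nonzero_right_inverse[OF c(2)] by blast
  have detL: "det L \<noteq> 0"
    using det_mult[OF c(2) L(1)] L(2) by auto
  let ?L = "(- \<epsilon>) \<cdot>\<^sub>m L"
  let ?C = "1\<^sub>m k \<oplus>\<^sub>m ?L"
  have eps': "cnj \<epsilon> = \<epsilon>" "\<epsilon> * \<epsilon> = 1" "\<epsilon> \<noteq> 0" using eps by auto
  have LH: "L\<^sup>H * M12\<^sup>H = 1\<^sub>m k" using L c by (simp add: adjoint_mult[symmetric])
  have Cc: "?C \<in> carrier_mat (k + k) (k + k)" using L by auto
  have detC: "det ?C \<noteq> 0"
    using det_direct_sum[of "1\<^sub>m k" k ?L k] L detL eps' by simp
  have comm: "?C * ((z \<cdot>\<^sub>m 1\<^sub>m k) \<oplus>\<^sub>m ((1 / cnj z) \<cdot>\<^sub>m 1\<^sub>m k)) = ((z \<cdot>\<^sub>m 1\<^sub>m k) \<oplus>\<^sub>m ((1 / cnj z) \<cdot>\<^sub>m 1\<^sub>m k)) * ?C"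
  proof -
    have "(1 / cnj z) \<cdot>\<^sub>m ?L = (- \<epsilon>) \<cdot>\<^sub>m ((1 / cnj z) \<cdot>\<^sub>m L)"
      by (rule eq_matI) auto
    then show ?thesis using L(1) by (simp add: direct_sum_mult smult_mult_dim)
  qed
  have sum: "?C = four_block_mat (1\<^sub>m k) (0\<^sub>m k k) (0\<^sub>m k k) ?L"
    using L by (auto simp: direct_sum_def)
  have CH: "?C\<^sup>H = four_block_mat (1\<^sub>m k) (0\<^sub>m k k) (0\<^sub>m k k) ((- \<epsilon>) \<cdot>\<^sub>m L\<^sup>H)"
    unfolding direct_sum_adjoint using L eps' by (simp add: direct_sum_def adjoint_smult)
  have "((- \<epsilon>) \<cdot>\<^sub>m L\<^sup>H) * ((- \<epsilon>) \<cdot>\<^sub>m M12\<^sup>H) = 1\<^sub>m k"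
    using L c LH eps' by (simp add: smult_mult_dim) (intro eq_matI, auto simp: mult.assoc[symmetric])
  then have "?C\<^sup>H * M = four_block_mat (0\<^sub>m k k) M12 (1\<^sub>m k) (0\<^sub>m k k)"
    unfolding CH M' using L c
    by (subst mult_four_block_mat[of _ k k _ k _ k _ _ k _ k]) (auto intro!: cong_four_block_mat)
  moreover have "M12 * ?L = (- \<epsilon>) \<cdot>\<^sub>m 1\<^sub>m k" using L c by (simp add: smult_mult_dim)
  ultimately have "?C\<^sup>H * M * ?C = four_block_mat (0\<^sub>m k k) ((- \<epsilon>) \<cdot>\<^sub>m 1\<^sub>m k) (1\<^sub>m k) (0\<^sub>m k k)"
    unfolding sum using L c
    by (simp, subst mult_four_block_mat[of _ k k _ k _ k _ _ k _ k]) (auto intro!: cong_four_block_mat)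
  moreover have "((- \<epsilon>) \<cdot>\<^sub>m 1\<^sub>m k) * ((- \<epsilon>) \<cdot>\<^sub>m 1\<^sub>m k) = (1\<^sub>m k :: complex mat)"
    using eps' by (simp add: smult_mult_dim) (intro eq_matI, auto simp: mult.assoc[symmetric])
  ultimately have "?C\<^sup>H * M * ?C * four_block_mat (0\<^sub>m k k) (1\<^sub>m k) ((- \<epsilon>) \<cdot>\<^sub>m 1\<^sub>m k) (0\<^sub>m k k) = 1\<^sub>m (k + k)"
    by (simp, subst mult_four_block_mat[of _ k k _ k _ k _ _ k _ k]) (auto intro!: cong_four_block_mat)
  then show ?thesis using that[OF Cc detC comm] by blast
qed

section \<open>Normal form of the whole form\<close>

definition block_size :: "nat \<Rightarrow> (nat \<Rightarrow> nat) \<Rightarrow> nat \<Rightarrow> nat" where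
  "block_size l m j = (if j \<le> l then m j + m j else m j)"

definition block_spectrum :: "nat \<Rightarrow> (nat \<Rightarrow> complex) \<Rightarrow> nat \<Rightarrow> complex set" where
  "block_spectrum l ev j = (if j \<le> l then {ev j, 1 / cnj (ev j)} else {ev j})"

text \<open>What the block of the Jordan form with index j becomes when its nilpotent part vanishes.\<close>

definition scalar_block :: "nat \<Rightarrow> (nat \<Rightarrow> complex) \<Rightarrow> (nat \<Rightarrow> nat) \<Rightarrow> nat \<Rightarrow> complex mat" where
  "scalar_block l ev m j =
     (if j \<le> l then (ev j \<cdot>\<^sub>m 1\<^sub>m (m j)) \<oplus>\<^sub>m ((1 / cnj (ev j)) \<cdot>\<^sub>m 1\<^sub>m (m j))
      else ev j \<cdot>\<^sub>m 1\<^sub>m (m j))"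

text \<open>The argument E chooses the sign matrices of the blocks with unimodular eigenvalue.\<close>

abbreviation target_block :: "complex \<Rightarrow> nat \<Rightarrow> (nat \<Rightarrow> nat) \<Rightarrow> (nat \<Rightarrow> complex mat) \<Rightarrow> nat \<Rightarrow> complex mat" where
  "target_block \<epsilon> l m E j \<equiv>
     (if j \<le> l
      then four_block_mat (0\<^sub>m (m j) (m j)) (1\<^sub>m (m j)) ((- \<epsilon>) \<cdot>\<^sub>m 1\<^sub>m (m j)) (0\<^sub>m (m j) (m j))
      else E j)"

lemma scalar_block_diagonal:
  "diagonal_in (block_spectrum l ev j) (block_size l m j) (scalar_block l ev m j)"
  by (auto simp: block_spectrum_def block_size_def scalar_block_def
      intro!: diagonal_in_direct_sum diagonal_in_scalar)

lemma scalar_blocks_diagonal: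
  "diagonal_in (\<Union>j\<in>set js. block_spectrum l ev j) (sum_list (map (block_size l m) js))
     (diag_block_mat (map (scalar_block l ev m) js))"
proof (induction js)
  case Nil
  then show ?case by (auto simp: diagonal_in_def)
next
  case (Cons j js)
  then show ?case unfolding list.map diag_block_mat_Cons sum_list.Cons
    by (intro diagonal_in_direct_sum)
       (auto intro: diagonal_in_mono[OF scalar_block_diagonal] diagonal_in_mono[OF Cons.IH])
qed

lemma single_block_normal_form:
  assumes eps: "\<epsilon> \<in> {1, - 1}"
    and paired: "j \<le> l \<Longrightarrow> ev j \<noteq> 0 \<and> cmod (ev j) \<noteq> 1"
    and M: "M \<in> carrier_mat (block_size l m j) (block_size l m j)"
    and MH: "M\<^sup>H = (- \<epsilon>) \<cdot>\<^sub>m M" and det: "det M \<noteq> 0"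
    and inv: "(scalar_block l ev m j)\<^sup>H * M * scalar_block l ev m j = M"
  shows "\<exists>C E. C \<in> carrier_mat (block_size l m j) (block_size l m j) \<and> det C \<noteq> 0 \<and>
    C * scalar_block l ev m j = scalar_block l ev m j * C \<and>
    (l < j \<longrightarrow> sign_diag \<epsilon> (m j) E) \<and>
    C\<^sup>H * M * C * target_block \<epsilon> l m (\<lambda>_. E) j = 1\<^sub>m (block_size l m j)"
proof (cases "j \<le> l")
  case True
  have size: "block_size l m j = m j + m j" and
    block: "scalar_block l ev m j = (ev j \<cdot>\<^sub>m 1\<^sub>m (m j)) \<oplus>\<^sub>m ((1 / cnj (ev j)) \<cdot>\<^sub>m 1\<^sub>m (m j))"
    using True by (auto simp: block_size_def scalar_block_def)
  have ev: "cmod (ev j) \<noteq> 1" "ev j \<noteq> 0" using paired True by auto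
  obtain C where C: "C \<in> carrier_mat (m j + m j) (m j + m j)" "det C \<noteq> 0"
    "C * scalar_block l ev m j = scalar_block l ev m j * C"
    "C\<^sup>H * M * C * four_block_mat (0\<^sub>m (m j) (m j)) (1\<^sub>m (m j)) ((- \<epsilon>) \<cdot>\<^sub>m 1\<^sub>m (m j)) (0\<^sub>m (m j) (m j))
      = 1\<^sub>m (m j + m j)"
    unfolding block
    by (rule reciprocal_pair_normal_form[OF M[unfolded size] eps MH det ev inv[unfolded block]])
  have "\<not> l < j" using True by simp
  then show ?thesis unfolding size if_P[OF True] using C by blast
next
  case False
  have size: "block_size l m j = m j" and block: "scalar_block l ev m j = ev j \<cdot>\<^sub>m 1\<^sub>m (m j)"
    using False by (auto simp: block_size_def scalar_block_def)
  obtain C E where CE: "C \<in> carrier_mat (m j) (m j)" "det C \<noteq> 0" "sign_diag \<epsilon> (m j) E"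
      "C\<^sup>H * M * C * E = 1\<^sub>m (m j)"
    by (rule unimodular_block_normal_form[OF M[unfolded size] eps MH det])
  moreover have "C * (ev j \<cdot>\<^sub>m 1\<^sub>m (m j)) = (ev j \<cdot>\<^sub>m 1\<^sub>m (m j)) * C"
    using CE(1) by (simp add: smult_mult_dim)
  ultimately show ?thesis using False unfolding size block by auto
qed

lemma target_block_carrier:
  assumes "l < j \<Longrightarrow> sign_diag \<epsilon> (m j) (E j)"
  shows "target_block \<epsilon> l m E j \<in> carrier_mat (block_size l m j) (block_size l m j)"
  using assms by (auto simp: block_size_def sign_diag_def)

lemma target_blocks_carrier:
  assumes "\<forall>j\<in>set js. l < j \<longrightarrow> sign_diag \<epsilon> (m j) (E j)"
  shows "diag_block_mat (map (target_block \<epsilon> l m E) js)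
    \<in> carrier_mat (sum_list (map (block_size l m) js)) (sum_list (map (block_size l m) js))"
  using assms
proof (induction js)
  case (Cons j js)
  then show ?case unfolding list.map diag_block_mat_Cons sum_list.Cons
    by (intro direct_sum_carrier target_block_carrier) auto
qed auto

text \<open>Peel off the first block of J. The two off-diagonal blocks of M relate eigenvalues s and t with
  conj(s) t \<noteq> 1, so they vanish, and both remaining diagonal blocks inherit all hypotheses.\<close>

lemma simultaneous_normal_form:
  assumes eps: "\<epsilon> \<in> {1, - 1}"
    and paired: "\<forall>j\<in>set js. j \<le> l \<longrightarrow> ev j \<noteq> 0 \<and> cmod (ev j) \<noteq> 1"
    and separated: "\<forall>i\<in>set js. \<forall>j\<in>set js. i \<noteq> j \<longrightarrow>
      (\<forall>s\<in>block_spectrum l ev i. \<forall>t\<in>block_spectrum l ev j. cnj s * t \<noteq> 1)"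
    and dist: "distinct js"
    and k: "k = sum_list (map (block_size l m) js)"
    and J: "J = diag_block_mat (map (scalar_block l ev m) js)"
    and M: "M \<in> carrier_mat k k" and MH: "M\<^sup>H = (- \<epsilon>) \<cdot>\<^sub>m M" and det: "det M \<noteq> 0"
    and inv: "J\<^sup>H * M * J = M"
  shows "\<exists>C E. C \<in> carrier_mat k k \<and> det C \<noteq> 0 \<and> C * J = J * C \<and>
    (\<forall>j\<in>set js. l < j \<longrightarrow> sign_diag \<epsilon> (m j) (E j)) \<and>
    C\<^sup>H * M * C * diag_block_mat (map (target_block \<epsilon> l m E) js) = 1\<^sub>m k"
  using paired separated dist k J M MH det inv
proof (induction js arbitrary: k J M)
  case Nil
  then show ?case by (intro exI[of _ "1\<^sub>m 0"]) auto
next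
  case (Cons j js)
  define a where "a = block_size l m j"
  define b where "b = sum_list (map (block_size l m) js)"
  define S where "S = (\<Union>i\<in>set js. block_spectrum l ev i)"
  let ?B = "scalar_block l ev m j" and ?R = "diag_block_mat (map (scalar_block l ev m) js)"
  have k: "k = a + b" using Cons.prems(4) by (simp add: a_def b_def)
  have J: "J = ?B \<oplus>\<^sub>m ?R" unfolding Cons.prems(5) list.map diag_block_mat_Cons ..
  note M = Cons.prems(6)[unfolded k] and MH = Cons.prems(7) and det = Cons.prems(8)
    and inv = Cons.prems(9)[unfolded J]
  have B: "diagonal_in (block_spectrum l ev j) a ?B" unfolding a_def by (rule scalar_block_diagonal)
  have R: "diagonal_in S b ?R" unfolding S_def b_def by (rule scalar_blocks_diagonal)
  have Bc: "?B \<in> carrier_mat a a" and Rc: "?R \<in> carrier_mat b b" using B R by (auto simp: diagonal_in_def)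
  obtain M11 M12 M21 M22 where Meq: "M = four_block_mat M11 M12 M21 M22"
    and c: "M11 \<in> carrier_mat a a" "M12 \<in> carrier_mat a b" "M21 \<in> carrier_mat b a" "M22 \<in> carrier_mat b b"
    and i: "?B\<^sup>H * M11 * ?B = M11" "?B\<^sup>H * M12 * ?R = M12" "?R\<^sup>H * M21 * ?B = M21" "?R\<^sup>H * M22 * ?R = M22"
    by (rule invariant_form_blocks[OF B R M inv]) blast
  have ne: "cnj s * t \<noteq> 1" "cnj t * s \<noteq> 1" if "s \<in> block_spectrum l ev j" "t \<in> S" for s t
  proof -
    from that obtain i where "i \<in> set js" "t \<in> block_spectrum l ev i" by (auto simp: S_def)
    then show "cnj s * t \<noteq> 1" "cnj t * s \<noteq> 1" using that(1) Cons.prems(2,3) by auto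
  qed
  have "M12 = 0\<^sub>m a b" by (rule diagonal_intertwiner_zero[OF B R c(2) i(2) ne(1)])
  moreover have "M21 = 0\<^sub>m b a" by (rule diagonal_intertwiner_zero[OF R B c(3) i(3) ne(2)])
  ultimately have Ms: "M = M11 \<oplus>\<^sub>m M22" using Meq c by (simp add: direct_sum_def)
  have "M11\<^sup>H = (- \<epsilon>) \<cdot>\<^sub>m M11" "M22\<^sup>H = (- \<epsilon>) \<cdot>\<^sub>m M22"
    using direct_sum_eqD[of "M11\<^sup>H" "M22\<^sup>H" "(- \<epsilon>) \<cdot>\<^sub>m M11" "(- \<epsilon>) \<cdot>\<^sub>m M22" a b] MH c
    unfolding Ms direct_sum_adjoint direct_sum_smult by auto
  note MH' = this
  have det': "det M11 \<noteq> 0" "det M22 \<noteq> 0"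
    using det det_direct_sum[OF c(1,4)] unfolding Ms by auto
  have "j \<le> l \<Longrightarrow> ev j \<noteq> 0 \<and> cmod (ev j) \<noteq> 1" using Cons.prems(1) by simp
  from single_block_normal_form[OF eps this c(1)[unfolded a_def] MH'(1) det'(1) i(1)]
  obtain C1 E1 where C1: "C1 \<in> carrier_mat a a" "det C1 \<noteq> 0" "C1 * ?B = ?B * C1"
    and E1: "l < j \<longrightarrow> sign_diag \<epsilon> (m j) E1"
    and N1: "C1\<^sup>H * M11 * C1 * target_block \<epsilon> l m (\<lambda>_. E1) j = 1\<^sub>m a"
    unfolding a_def by auto
  have "\<exists>C E. C \<in> carrier_mat b b \<and> det C \<noteq> 0 \<and> C * ?R = ?R * C \<and>
    (\<forall>j\<in>set js. l < j \<longrightarrow> sign_diag \<epsilon> (m j) (E j)) \<and>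
    C\<^sup>H * M22 * C * diag_block_mat (map (target_block \<epsilon> l m E) js) = 1\<^sub>m b"
    by (rule Cons.IH[OF _ _ _ b_def refl c(4) MH'(2) det'(2) i(4)]) (use Cons.prems(1-3) in auto)
  then obtain C2 E2 where C2: "C2 \<in> carrier_mat b b" "det C2 \<noteq> 0" "C2 * ?R = ?R * C2"
    and E2: "\<forall>j\<in>set js. l < j \<longrightarrow> sign_diag \<epsilon> (m j) (E2 j)"
    and N2: "C2\<^sup>H * M22 * C2 * diag_block_mat (map (target_block \<epsilon> l m E2) js) = 1\<^sub>m b" by auto
  \<comment> \<open>the indices are distinct, so the update at j leaves the choices for the other blocks intact\<close>
  define E where "E = E2(j := E1)"
  define T where "T = diag_block_mat (map (target_block \<epsilon> l m E2) js)"
  have Tc: "T \<in> carrier_mat b b"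
    unfolding T_def b_def by (rule target_blocks_carrier[OF E2])
  have Ec: "target_block \<epsilon> l m (\<lambda>_. E1) j \<in> carrier_mat a a"
    using target_block_carrier[of l j \<epsilon> m "\<lambda>_. E1"] E1 unfolding a_def by simp
  have "map (target_block \<epsilon> l m E) js = map (target_block \<epsilon> l m E2) js"
    using Cons.prems(3) by (auto simp: E_def)
  note same = this
  have target: "diag_block_mat (map (target_block \<epsilon> l m E) (j # js)) = target_block \<epsilon> l m (\<lambda>_. E1) j \<oplus>\<^sub>m T"
    unfolding list.map diag_block_mat_Cons T_def same by (simp add: E_def)
  let ?C = "C1 \<oplus>\<^sub>m C2"
  have "?C \<in> carrier_mat k k" unfolding k using C1 C2 by auto
  moreover have "det ?C \<noteq> 0" using det_direct_sum[OF C1(1) C2(1)] C1 C2 by simp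
  moreover have "?C * J = J * ?C"
    unfolding J using C1 C2 Bc Rc by (simp add: direct_sum_mult)
  moreover have "\<forall>i\<in>set (j # js). l < i \<longrightarrow> sign_diag \<epsilon> (m i) (E i)"
    using E1 E2 by (auto simp: E_def)
  moreover have "?C\<^sup>H * M * ?C * diag_block_mat (map (target_block \<epsilon> l m E) (j # js)) = 1\<^sub>m k"
  proof -
    have "?C\<^sup>H * M * ?C = (C1\<^sup>H * M11 * C1) \<oplus>\<^sub>m (C2\<^sup>H * M22 * C2)"
      unfolding Ms direct_sum_adjoint using C1 C2 c by (simp add: direct_sum_mult)
    moreover have "\<dots> * (target_block \<epsilon> l m (\<lambda>_. E1) j \<oplus>\<^sub>m T)
      = (C1\<^sup>H * M11 * C1 * target_block \<epsilon> l m (\<lambda>_. E1) j) \<oplus>\<^sub>m (C2\<^sup>H * M22 * C2 * T)"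
      by (rule direct_sum_mult) (use C1 C2 Ec Tc in auto)
    ultimately show ?thesis
      unfolding target N1 N2[folded T_def] direct_sum_one k by simp
  qed
  ultimately show ?case by blast
qed

text \<open>The eigenvalues of a block are closed under s \<mapsto> 1 / conj(s): a block off the unit circle contains
  both members of the pair, and on the unit circle the map is the identity. So conj(s) t = 1 would
  put t into the spectrum of the block of s.\<close>

lemma block_spectra_separated:
  assumes "j \<le> l \<Longrightarrow> ev j \<noteq> 0" "l < j \<Longrightarrow> cmod (ev j) = 1"
    and disj: "block_spectrum l ev j \<inter> T = {}"
    and s: "s \<in> block_spectrum l ev j" and t: "t \<in> T"
  shows "cnj s * t \<noteq> 1"
proof
  assume st: "cnj s * t = 1"
  then have "cnj s \<noteq> 0" by auto
  with st have "t = 1 / cnj s" by (simp add: field_simps)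
  moreover have "1 / cnj s \<in> block_spectrum l ev j"
  proof (cases "j \<le> l")
    case True
    then show ?thesis using s by (auto simp: block_spectrum_def)
  next
    case False
    then have "cmod (ev j) = 1" using assms(2) by simp
    then have "ev j * cnj (ev j) = 1" using complex_norm_square[of "ev j"] by simp
    moreover have "ev j \<noteq> 0" using \<open>cmod (ev j) = 1\<close> by auto
    ultimately show ?thesis using False s by (auto simp: block_spectrum_def field_simps)
  qed
  ultimately show False using disj t by auto
qed

lemma chain_free_jordan_form_scalar:
  assumes jf: "jordan_form n l r ev m N J" and cf: "chain_free J" and j: "j \<in> {1..r}"
  shows "J_block l ev m N j = scalar_block l ev m j"
proof -
  have N: "superdiag_nilpotent (m i) (N i)" if "i \<in> {1..r}" for i
    using jf that by (auto simp: jordan_form_def)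
  have Nc: "N i \<in> carrier_mat (m i) (m i)" if "i \<in> {1..r}" for i
    using N[OF that] by (simp add: superdiag_nilpotent_def)
  have pair: "J_block l ev m N i = (ev i \<cdot>\<^sub>m 1\<^sub>m (m i) + N i) \<oplus>\<^sub>m ((1 / cnj (ev i)) \<cdot>\<^sub>m 1\<^sub>m (m i) + N i)"
    if "i \<le> l" for i
    using that unfolding J_block_def by (simp only: if_True diag_block_mat_Cons[of _ "[_]"] diag_block_mat_singleton)
  have single: "J_block l ev m N i = ev i \<cdot>\<^sub>m 1\<^sub>m (m i) + N i" if "\<not> i \<le> l" for i
    using that by (simp add: J_block_def)
  have "chain_free (J_block l ev m N j)"
  proof (rule chain_free_diag_block)
    show "chain_free (diag_block_mat (map (J_block l ev m N) [1..<Suc r]))"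
      using cf jf by (simp add: jordan_form_def)
    show "J_block l ev m N j \<in> set (map (J_block l ev m N) [1..<Suc r])"
      using j by (auto simp del: upt_Suc)
    fix B assume "B \<in> set (map (J_block l ev m N) [1..<Suc r])"
    then obtain i where "i \<in> set [1..<Suc r]" and B: "B = J_block l ev m N i"
      unfolding set_map by (rule imageE)
    then have "i \<in> {1..r}" by (auto simp del: upt_Suc)
    with B show "square_mat B" using Nc[of i] by (cases "i \<le> l") (auto simp: pair single B)
  qed
  have c: "c \<cdot>\<^sub>m 1\<^sub>m (m j) + N j \<in> carrier_mat (m j) (m j)" for c using Nc[OF j] by simp
  have "chain_free (ev j \<cdot>\<^sub>m 1\<^sub>m (m j) + N j)"
  proof (cases "j \<le> l")
    case True
    then show ?thesis
      using chain_free_direct_sum(1)[OF c c] \<open>chain_free (J_block l ev m N j)\<close>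
      by (simp add: pair)
  next
    case False
    then show ?thesis using \<open>chain_free (J_block l ev m N j)\<close> by (simp add: single)
  qed
  then have "N j = 0\<^sub>m (m j) (m j)" by (rule chain_free_jordan_block[OF N[OF j]])
  then show ?thesis by (cases "j \<le> l") (simp_all add: pair single scalar_block_def)
qed

theorem theorem3p8:
  fixes \<epsilon> :: complex and n l r :: nat
    and A Q X J :: "complex mat"
    and ev :: "nat \<Rightarrow> complex" and m :: "nat \<Rightarrow> nat" and N :: "nat \<Rightarrow> complex mat"
  assumes "\<epsilon> \<in> {1, - 1}" and "1 \<le> n"
    and "A \<in> carrier_mat n n" and "Q \<in> carrier_mat n n"
    and "invertible_mat A" and "mat_adjoint Q = \<epsilon> \<cdot>\<^sub>m Q"
    and "standard_pair n \<epsilon> A Q X J"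
    and "jordan_form n l r ev m N J"
    and "\<forall>z. polymat_eigenvalue (pal_poly \<epsilon> A Q) z \<longrightarrow> semisimple_eigenvalue (pal_poly \<epsilon> A Q) z"
  shows "\<exists>Xt E.
     standard_pair n \<epsilon> A Q Xt J \<and>
     (\<forall>j\<in>{l+1..r}. sign_diag \<epsilon> (m j) (E j)) \<and>
     Gamma_mat A Q Xt J \<in> S_set J \<epsilon> \<and>
     Gamma_mat A Q Xt J = diag_block_mat (map (\<lambda>j.
        if j \<le> l
        then four_block_mat (0\<^sub>m (m j) (m j)) (1\<^sub>m (m j)) ((- \<epsilon>) \<cdot>\<^sub>m 1\<^sub>m (m j)) (0\<^sub>m (m j) (m j))
        else E j) [1..<Suc r])"
proof -
  note eps = assms(1) and A = assms(3) and Q = assms(4) and Qe = assms(6) and sp = assms(7)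
    and jf = assms(8)
  let ?js = "[1..<Suc r]"
  have detA: "det A \<noteq> 0" using assms(5) invertible_iff_det_nonzero[OF A] by simp
  have X: "X \<in> carrier_mat n (2*n)" and J: "J \<in> carrier_mat (2*n) (2*n)"
    and invV: "invertible_mat (X @\<^sub>r (X * J))"
    and eq: "A * X * (J * J) + Q * X * J + \<epsilon> \<cdot>\<^sub>m (A\<^sup>H * X) = 0\<^sub>m n (2 * n)"
    using sp by (auto simp: standard_pair_def)
  have "X @\<^sub>r (X * J) \<in> carrier_mat (2*n) (2*n)"
    using carrier_append_rows[OF X, of "X * J" n] X J by (simp add: mult_2)
  then have detV: "det (X @\<^sub>r (X * J)) \<noteq> 0" using invV invertible_iff_det_nonzero by blast
  have "chain_free J"
    by (rule semisimple_imp_chain_free[OF A Q detA _ sp assms(9)]) (use eps in auto)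
  note block = chain_free_jordan_form_scalar[OF jf this]
  have Jeq: "J = diag_block_mat (map (scalar_block l ev m) ?js)"
  proof -
    have "map (J_block l ev m N) ?js = map (scalar_block l ev m) ?js"
      by (rule map_cong) (auto intro!: block simp del: upt_Suc)
    then show ?thesis using jf by (simp only: jordan_form_def)
  qed
  have k: "2 * n = sum_list (map (block_size l m) ?js)"
    using scalar_blocks_diagonal[where js = ?js and l = l and ev = ev and m = m] J unfolding Jeq[symmetric]
    by (auto simp: diagonal_in_def simp del: upt_Suc)
  have diagJ: "diagonal_in (\<Union>j\<in>set ?js. block_spectrum l ev j) (2 * n) J"
    using scalar_blocks_diagonal[where js = ?js and l = l and ev = ev and m = m] unfolding Jeq[symmetric] k .
  have lr: "l \<le> r" and mpos: "\<And>j. j \<in> {1..r} \<Longrightarrow> 1 \<le> m j"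
    and ev1: "\<And>j. j \<in> {1..l} \<Longrightarrow> ev j \<noteq> 0 \<and> cmod (ev j) \<noteq> 1"
    and ev2: "\<And>j. j \<in> {l+1..r} \<Longrightarrow> cmod (ev j) = 1"
    and spec: "\<And>i j. i \<in> {1..r} \<Longrightarrow> j \<in> {1..r} \<Longrightarrow> i \<noteq> j \<Longrightarrow>
      spectrum (J_block l ev m N i) \<inter> spectrum (J_block l ev m N j) = {}"
    using jf by (auto simp: jordan_form_def)
  have "ev j \<noteq> 0" if "j \<in> {1..r}" for j
    using ev1[of j] ev2[of j] that by (cases "j \<le> l") auto
  then have "0 \<notin> (\<Union>j\<in>set ?js. block_spectrum l ev j)"
    by (auto simp: block_spectrum_def simp del: upt_Suc)
  then have "det J \<noteq> 0" by (rule diagonal_in_det_nonzero[OF diagJ])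
  then obtain Ji where Ji: "Ji \<in> carrier_mat (2*n) (2*n)" and JJi: "J * Ji = 1\<^sub>m (2*n)"
    using det_nonzero_right_inverse[OF J] by blast
  have Jinv: "mat_inv J = Ji" by (rule mat_inv_eqI[OF J Ji JJi])
  have Gamma: "Gamma_mat A Q Y J = mat_inv (coupling A Q Y J Ji)" if "Y \<in> carrier_mat n (2*n)" for Y
    unfolding Gamma_mat_def Jinv using coupling_product[OF A Q that J Ji] A by simp
  have spectrum_sub: "block_spectrum l ev j \<subseteq> spectrum (scalar_block l ev m j)" if j: "j \<in> {1..r}" for j
  proof
    fix s assume s: "s \<in> block_spectrum l ev j"
    have "\<exists>i<block_size l m j. scalar_block l ev m j $$ (i, i) = s"
    proof (cases "s = ev j")
      case True
      then show ?thesis using mpos[OF j]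
        by (intro exI[of _ 0]) (auto simp: block_size_def scalar_block_def direct_sum_def)
    next
      case False
      then show ?thesis using mpos[OF j] s
        by (intro exI[of _ "m j"])
           (auto simp: block_size_def scalar_block_def direct_sum_def block_spectrum_def split: if_splits)
    qed
    then show "s \<in> spectrum (scalar_block l ev m j)"
      using diagonal_in_spectrum[OF scalar_block_diagonal] by blast
  qed
  have separated: "\<forall>i\<in>set ?js. \<forall>j\<in>set ?js. i \<noteq> j \<longrightarrow>
      (\<forall>s\<in>block_spectrum l ev i. \<forall>t\<in>block_spectrum l ev j. cnj s * t \<noteq> 1)"
  proof (intro ballI impI)
    fix i j s t assume "i \<in> set ?js" "j \<in> set ?js" and ne: "i \<noteq> j"
      and st: "s \<in> block_spectrum l ev i" "t \<in> block_spectrum l ev j"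
    then have ij: "i \<in> {1..r}" "j \<in> {1..r}"
      by (auto simp del: upt_Suc)
    have "block_spectrum l ev i \<inter> block_spectrum l ev j = {}"
      using spec[OF ij ne] spectrum_sub[OF ij(1)] spectrum_sub[OF ij(2)]
      unfolding block[OF ij(1)] block[OF ij(2)] by blast
    then show "cnj s * t \<noteq> 1"
      using block_spectra_separated[of i l ev "block_spectrum l ev j" s t] st ij ev1[of i] ev2[of i] by auto
  qed
  let ?M = "coupling A Q X J Ji"
  have M: "?M \<in> carrier_mat (2*n) (2*n)" by (rule coupling_carrier[OF A Q X J Ji])
  have paired: "\<forall>j\<in>set ?js. j \<le> l \<longrightarrow> ev j \<noteq> 0 \<and> cmod (ev j) \<noteq> 1"
    using ev1 by (auto simp del: upt_Suc)
  obtain C E where C: "C \<in> carrier_mat (2*n) (2*n)" "det C \<noteq> 0" "C * J = J * C"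
    and E: "\<forall>j\<in>set ?js. l < j \<longrightarrow> sign_diag \<epsilon> (m j) (E j)"
    and normal: "C\<^sup>H * ?M * C * diag_block_mat (map (target_block \<epsilon> l m E) ?js) = 1\<^sub>m (2*n)"
    using simultaneous_normal_form[OF eps paired separated distinct_upt k Jeq M
        coupling_symmetry(1)[OF A Q X J Ji JJi eps Qe eq]
        coupling_det_nonzero[OF A Q X J Ji JJi detA detV]
        coupling_symmetry(2)[OF A Q X J Ji JJi eps Qe eq]] by blast
  define G where "G = diag_block_mat (map (target_block \<epsilon> l m E) ?js)"
  have G: "G \<in> carrier_mat (2*n) (2*n)" unfolding G_def k by (rule target_blocks_carrier[OF E])
  have XC: "X * C \<in> carrier_mat n (2*n)" using X C by simp
  have spC: "standard_pair n \<epsilon> A Q (X * C) J"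
    by (rule standard_pair_change[OF sp A Q C(1,3,2)])
  then have eqC: "A * (X * C) * (J * J) + Q * (X * C) * J + \<epsilon> \<cdot>\<^sub>m (A\<^sup>H * (X * C)) = 0\<^sub>m n (2 * n)"
    by (simp add: standard_pair_def)
  let ?MC = "coupling A Q (X * C) J Ji"
  have MC: "?MC \<in> carrier_mat (2*n) (2*n)" by (rule coupling_carrier[OF A Q XC J Ji])
  have MCG: "?MC * G = 1\<^sub>m (2*n)"
    unfolding coupling_change_of_pair[OF A Q X J Ji JJi C(1,3)] G_def by (rule normal)
  have GammaG: "Gamma_mat A Q (X * C) J = G"
    unfolding Gamma[OF XC] by (rule mat_inv_eqI[OF MC G MCG])
  have "G \<in> S_set J \<epsilon>"
    by (rule mem_S_setI[OF J Ji JJi MC G MCG eps coupling_symmetry[OF A Q XC J Ji JJi eps Qe eqC]])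
  moreover have "\<forall>j\<in>{l+1..r}. sign_diag \<epsilon> (m j) (E j)"
    using E by (auto simp del: upt_Suc)
  ultimately show ?thesis using spC unfolding GammaG[symmetric] G_def[symmetric]
    using GammaG G_def by (intro exI[of _ "X * C"] exI[of _ E]) (simp del: upt_Suc)
qed

end
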